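(* Let $N\ge1$, $W=S_N$ and let $w_0\in W$ be the longest element. Let $\varepsilon:\mathbb{C}[W]\to\mathbb{C}$ be the linear map with $\varepsilon(t_1)=1$ and $\varepsilon(t_w)=0$ for $w\neq1$, and let $\beta_\infty$ be the Hermitian form on the left $W$-module $\mathbb{C}[W]$ given by $$\beta_\infty(t_w,t_{w'})=\varepsilon(t_{w'^{-1}}t_wt_{w_0})\qquad(w,w'\in W).$$ (This is the form at infinity for unramified representations.) Then the signature character of $\beta_\infty$ is $(\sigma_{\infty,\lambda})_{\lambda\in\hat W}\in\mathbb{Z}^{\hat W}$ with $$\sigma_{\infty,\lambda}=\chi_\lambda(w_0)\qquad\text{for all }\lambda\in\hat W.$$
   Context: $\hat W$ is the set of isomorphism classes of irreducible complex representations of $W$, $\chi_\lambda$ the character of $\lambda$; $t_w$ ($w\in W$) is the standard basis of $\mathbb{C}[W]$. Hermitian forms are extended from the basis linearly in the first and conjugate-linearly in the second variable. For a finite-dimensional $W$-module $V$ with a non-degenerate $W$-invariant Hermitian form $\beta$, decompose $V$ orthogonally into irreducible $W$-submodules $V_i$; the form on each $V_i$ is definite, and the signature character is the tuple $(\sigma_\lambda)_\lambda$ where $\sigma_\lambda$ is the number of $i$ with $V_i\cong\lambda$ and $\beta|_{V_i}$ positive definite minus the number with $V_i\cong\lambda$ and $\beta|_{V_i}$ negative definite. The form above is the specialization to the unramified case ($S=\emptyset$, standard Levi subgroup equal to the torus, $U$ trivial) of the form at infinity on the standard module $X(S,U,\nu)\cong\mathbb{C}[W]\otimes_{\mathbb{C}[W_M]}U$.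 *)

theory Defs
  imports Complex_Main "HOL-Algebra.Sym_Groups" "HOL-Library.FuncSet" "HOL-Library.Function_Algebras"
    "HOL-Combinatorics.Transposition"
begin

section \<open>Finite-dimensional complex representations\<close>

text \<open>
  The underlying space of a representation is a finite-dimensional subspace \<open>vecs R\<close> of an ambient
  complex vector space (a type with scalar multiplication \<open>scal R\<close>); the values of \<open>act R\<close> outside
  of \<open>vecs R\<close> are irrelevant.  The qualifier \<open>Modules\<close> distinguishes the locale of type-based
  modules from the locale of the same name in HOL-Algebra.
\<close>

record ('g, 'v) cplx_rep =
  scal :: "complex \<Rightarrow> 'v \<Rightarrow> 'v"
  vecs :: "'v set"
  act :: "'g \<Rightarrow> 'v \<Rightarrow> 'v"

definition is_subspace :: "('g, 'v::ab_group_add) cplx_rep \<Rightarrow> 'v set \<Rightarrow> bool" where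
  "is_subspace R U \<longleftrightarrow> Modules.module.subspace (scal R) U"

definition is_rep :: "('g, 'm) monoid_scheme \<Rightarrow> ('g, 'v::ab_group_add) cplx_rep \<Rightarrow> bool" where
  "is_rep G R \<longleftrightarrow>
     group G \<and> vector_space (scal R) \<and>
     (\<exists>B. finite B \<and> vecs R = Modules.module.span (scal R) B) \<and>
     (\<forall>g\<in>carrier G. \<forall>x\<in>vecs R. act R g x \<in> vecs R) \<and>
     (\<forall>g\<in>carrier G. \<forall>x\<in>vecs R. \<forall>y\<in>vecs R. act R g (x + y) = act R g x + act R g y) \<and>
     (\<forall>g\<in>carrier G. \<forall>c. \<forall>x\<in>vecs R. act R g (scal R c x) = scal R c (act R g x)) \<and>
     (\<forall>x\<in>vecs R. act R \<one>\<^bsub>G\<^esub> x = x) \<and>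
     (\<forall>g\<in>carrier G. \<forall>h\<in>carrier G. \<forall>x\<in>vecs R. act R (g \<otimes>\<^bsub>G\<^esub> h) x = act R g (act R h x))"

definition is_submodule ::
  "('g, 'm) monoid_scheme \<Rightarrow> ('g, 'v::ab_group_add) cplx_rep \<Rightarrow> 'v set \<Rightarrow> bool" where
  "is_submodule G R U \<longleftrightarrow>
     U \<subseteq> vecs R \<and> is_subspace R U \<and> (\<forall>g\<in>carrier G. \<forall>x\<in>U. act R g x \<in> U)"

definition subrep :: "('g, 'v) cplx_rep \<Rightarrow> 'v set \<Rightarrow> ('g, 'v) cplx_rep" where
  "subrep R U = R\<lparr>vecs := U\<rparr>"

definition irreducible_rep ::
  "('g, 'm) monoid_scheme \<Rightarrow> ('g, 'v::ab_group_add) cplx_rep \<Rightarrow> bool" where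
  "irreducible_rep G R \<longleftrightarrow>
     is_rep G R \<and> vecs R \<noteq> {0} \<and> (\<forall>U. is_submodule G R U \<longrightarrow> U = {0} \<or> U = vecs R)"

definition rep_iso ::
  "('g, 'm) monoid_scheme \<Rightarrow> ('g, 'v::ab_group_add) cplx_rep \<Rightarrow>
   ('g, 'u::ab_group_add) cplx_rep \<Rightarrow> bool" where
  "rep_iso G R L \<longleftrightarrow>
     (\<exists>f. bij_betw f (vecs R) (vecs L) \<and>
          (\<forall>x\<in>vecs R. \<forall>y\<in>vecs R. f (x + y) = f x + f y) \<and>
          (\<forall>c. \<forall>x\<in>vecs R. f (scal R c x) = scal L c (f x)) \<and>
          (\<forall>g\<in>carrier G. \<forall>x\<in>vecs R. f (act R g x) = act L g (f x)))"

text \<open>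
  The trace of \<open>act R g\<close> on \<open>vecs R\<close>: the sum of the diagonal coefficients with respect to a basis,
  which does not depend on the basis.
\<close>

definition rep_character :: "('g, 'v::ab_group_add) cplx_rep \<Rightarrow> 'g \<Rightarrow> complex" where
  "rep_character R g =
     (let B = (SOME B. \<not> Modules.module.dependent (scal R) B \<and>
                       Modules.module.span (scal R) B = vecs R)
      in \<Sum>b\<in>B. Modules.module.representation (scal R) B (act R g b) b)"


section \<open>Invariant Hermitian forms and signature characters\<close>

definition hermitian_form_on ::
  "('g, 'v::ab_group_add) cplx_rep \<Rightarrow> ('v \<Rightarrow> 'v \<Rightarrow> complex) \<Rightarrow> bool" where
  "hermitian_form_on R \<beta> \<longleftrightarrow>
     (\<forall>x\<in>vecs R. \<forall>y\<in>vecs R. \<forall>z\<in>vecs R. \<beta> (x + y) z = \<beta> x z + \<beta> y z) \<and>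
     (\<forall>c. \<forall>x\<in>vecs R. \<forall>y\<in>vecs R. \<beta> (scal R c x) y = c * \<beta> x y) \<and>
     (\<forall>x\<in>vecs R. \<forall>y\<in>vecs R. \<beta> y x = cnj (\<beta> x y))"

definition invariant_form_on ::
  "('g, 'm) monoid_scheme \<Rightarrow> ('g, 'v::ab_group_add) cplx_rep \<Rightarrow>
   ('v \<Rightarrow> 'v \<Rightarrow> complex) \<Rightarrow> bool" where
  "invariant_form_on G R \<beta> \<longleftrightarrow>
     (\<forall>g\<in>carrier G. \<forall>x\<in>vecs R. \<forall>y\<in>vecs R. \<beta> (act R g x) (act R g y) = \<beta> x y)"

definition nondegenerate_on ::
  "('g, 'v::ab_group_add) cplx_rep \<Rightarrow> ('v \<Rightarrow> 'v \<Rightarrow> complex) \<Rightarrow> bool" where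
  "nondegenerate_on R \<beta> \<longleftrightarrow> (\<forall>x\<in>vecs R. (\<forall>y\<in>vecs R. \<beta> x y = 0) \<longrightarrow> x = 0)"

text \<open>The values \<open>\<beta> x x\<close> of a Hermitian form are real.\<close>

definition positive_definite_on ::
  "'v::zero set \<Rightarrow> ('v \<Rightarrow> 'v \<Rightarrow> complex) \<Rightarrow> bool" where
  "positive_definite_on U \<beta> \<longleftrightarrow> (\<forall>x\<in>U. x \<noteq> 0 \<longrightarrow> Re (\<beta> x x) > 0)"

definition negative_definite_on ::
  "'v::zero set \<Rightarrow> ('v \<Rightarrow> 'v \<Rightarrow> complex) \<Rightarrow> bool" where
  "negative_definite_on U \<beta> \<longleftrightarrow> (\<forall>x\<in>U. x \<noteq> 0 \<longrightarrow> Re (\<beta> x x) < 0)"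

text \<open>
  A decomposition is given by the set of its summands; distinct summands of a direct sum of nonzero
  submodules are distinct as sets.
\<close>

definition orthogonal_decomposition ::
  "('g, 'm) monoid_scheme \<Rightarrow> ('g, 'v::ab_group_add) cplx_rep \<Rightarrow>
   ('v \<Rightarrow> 'v \<Rightarrow> complex) \<Rightarrow> 'v set set \<Rightarrow> bool" where
  "orthogonal_decomposition G R \<beta> D \<longleftrightarrow>
     finite D \<and>
     (\<forall>U\<in>D. is_submodule G R U \<and> irreducible_rep G (subrep R U)) \<and>
     (\<forall>x\<in>vecs R. \<exists>!u. u \<in> (\<Pi>\<^sub>E U\<in>D. U) \<and> x = (\<Sum>U\<in>D. u U)) \<and>
     (\<forall>U\<in>D. \<forall>U'\<in>D. U \<noteq> U' \<longrightarrow> (\<forall>x\<in>U. \<forall>y\<in>U'. \<beta> x y = 0))"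

definition signature_count ::
  "('g, 'm) monoid_scheme \<Rightarrow> ('g, 'v::ab_group_add) cplx_rep \<Rightarrow>
   ('v \<Rightarrow> 'v \<Rightarrow> complex) \<Rightarrow> 'v set set \<Rightarrow> ('g, 'u::ab_group_add) cplx_rep \<Rightarrow> int" where
  "signature_count G R \<beta> D L =
     int (card {U \<in> D. rep_iso G (subrep R U) L \<and> positive_definite_on U \<beta>}) -
     int (card {U \<in> D. rep_iso G (subrep R U) L \<and> negative_definite_on U \<beta>})"

text \<open>
  Isomorphism classes of irreducible representations enter through their representatives \<open>L\<close>:
  \<open>signature_count\<close> depends on \<open>L\<close> only up to isomorphism.  The well-definedness of the signature
  character (existence of a decomposition, definiteness of the summands, independence of the
  decomposition) is part of the predicate.
\<close>

definition has_signature_character ::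
  "('g, 'm) monoid_scheme \<Rightarrow> ('g, 'v::ab_group_add) cplx_rep \<Rightarrow>
   ('v \<Rightarrow> 'v \<Rightarrow> complex) \<Rightarrow> (('g, 'u::ab_group_add) cplx_rep \<Rightarrow> int) \<Rightarrow> bool" where
  "has_signature_character G R \<beta> \<sigma> \<longleftrightarrow>
     is_rep G R \<and> hermitian_form_on R \<beta> \<and> invariant_form_on G R \<beta> \<and> nondegenerate_on R \<beta> \<and>
     (\<exists>D. orthogonal_decomposition G R \<beta> D) \<and>
     (\<forall>D. orthogonal_decomposition G R \<beta> D \<longrightarrow>
        (\<forall>U\<in>D. positive_definite_on U \<beta> \<or> negative_definite_on U \<beta>) \<and>
        (\<forall>L. irreducible_rep G L \<longrightarrow> \<sigma> L = signature_count G R \<beta> D L))"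


section \<open>The group algebra and the form at infinity\<close>

text \<open>
  Elements of the group algebra of a finite group \<open>G\<close> are the functions vanishing outside of
  \<open>carrier G\<close>; addition is pointwise, multiplication is convolution.
\<close>

definition t_basis :: "'g \<Rightarrow> 'g \<Rightarrow> complex" where
  "t_basis w = (\<lambda>g. if g = w then 1 else 0)"

definition ga_mult ::
  "('g, 'm) monoid_scheme \<Rightarrow> ('g \<Rightarrow> complex) \<Rightarrow> ('g \<Rightarrow> complex) \<Rightarrow> 'g \<Rightarrow> complex" where
  "ga_mult G x y =
     (\<lambda>g. if g \<in> carrier G then \<Sum>h\<in>carrier G. x h * y (inv\<^bsub>G\<^esub> h \<otimes>\<^bsub>G\<^esub> g) else 0)"

definition group_algebra :: "('g, 'm) monoid_scheme \<Rightarrow> ('g, 'g \<Rightarrow> complex) cplx_rep" where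
  "group_algebra G =
     \<lparr>scal = (\<lambda>c x g. c * x g),
      vecs = {x. \<forall>g. g \<notin> carrier G \<longrightarrow> x g = 0},
      act = (\<lambda>w x. ga_mult G (t_basis w) x)\<rparr>"

definition ga_eps :: "('g, 'm) monoid_scheme \<Rightarrow> ('g \<Rightarrow> complex) \<Rightarrow> complex" where
  "ga_eps G x = x \<one>\<^bsub>G\<^esub>"

definition beta_infinity ::
  "('g, 'm) monoid_scheme \<Rightarrow> 'g \<Rightarrow> ('g \<Rightarrow> complex) \<Rightarrow> ('g \<Rightarrow> complex) \<Rightarrow> complex" where
  "beta_infinity G w0 x y =
     (\<Sum>w\<in>carrier G. \<Sum>w'\<in>carrier G. x w * cnj (y w') *
        ga_eps G (ga_mult G (ga_mult G (t_basis (inv\<^bsub>G\<^esub> w')) (t_basis w)) (t_basis w0)))"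


section \<open>The longest element of the symmetric group\<close>

definition coxeter_length :: "nat \<Rightarrow> (nat \<Rightarrow> nat) \<Rightarrow> nat" where
  "coxeter_length N w =
     (LEAST k. \<exists>is. length is = k \<and> set is \<subseteq> {1..<N} \<and>
        w = foldr (\<circ>) (map (\<lambda>i. transpose i (Suc i)) is) id)"

definition is_longest_element :: "nat \<Rightarrow> (nat \<Rightarrow> nat) \<Rightarrow> bool" where
  "is_longest_element N w0 \<longleftrightarrow>
     w0 \<in> carrier (sym_group N) \<and>
     (\<forall>w\<in>carrier (sym_group N). coxeter_length N w \<le> coxeter_length N w0)"

end

theory Submission
  imports Defs "HOL-Computational_Algebra.Fundamental_Theorem_Algebra"
begin

text \<open>
  Only \<open>w\<^sub>0\<^sup>2 = 1\<close> matters: it makes right multiplication by \<open>w\<^sub>0\<close> an involution \<open>r\<close> of the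
  group algebra which commutes with the left action, and \<open>\<beta>(x, y) = \<langle>r x, y\<rangle>\<close> for the standard inner
  product.  For irreducible \<open>L\<close>, the homomorphisms from \<open>L\<close> into the group algebra are the maps
  \<open>v \<mapsto> (g \<mapsto> l(g\<inverse> v))\<close> with \<open>l\<close> in the dual of \<open>L\<close>, and \<open>r\<close> acts on them by \<open>l \<mapsto> l \<circ> w\<^sub>0\<close>.
  A combination of embeddings of \<open>L\<close> onto positive summands of a decomposition cannot land in the
  \<open>-1\<close>-eigenspace of \<open>r\<close>, so there are at most \<open>dim L\<^sup>+\<close> of them, where \<open>L\<^sup>\<plusminus>\<close> are the
  eigenspaces of \<open>w\<^sub>0\<close> on \<open>L\<close>; likewise there are at most \<open>dim L\<^sup>-\<close> negative ones.  By Schur's lemma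
  the total number of summands isomorphic to \<open>L\<close> is at least \<open>dim L\<close>, so both bounds are equalities,
  and \<open>dim L\<^sup>+ - dim L\<^sup>-\<close> is the trace of \<open>w\<^sub>0\<close> on \<open>L\<close>.
\<close>

section \<open>Linear algebra\<close>

text \<open>Gaussian elimination, one equation at a time: if equation \<open>j0\<close> has a
  nonzero coefficient, its variable \<open>i0\<close> serves as pivot and is eliminated from the
  remaining equations. All dimension counts below reduce to this statement.\<close>

lemma homogeneous_system_nontrivial:
  fixes M :: "'i \<Rightarrow> 'j \<Rightarrow> 'a::field"
  assumes "finite J" "finite I" "card J < card I"
  shows "\<exists>a. (\<exists>i\<in>I. a i \<noteq> 0) \<and> (\<forall>j\<in>J. (\<Sum>i\<in>I. a i * M i j) = 0)"
  using assms
proof (induction J arbitrary: I M rule: finite_induct)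
  case empty
  then have "I \<noteq> {}" by auto
  then show ?case by (intro exI[of _ "\<lambda>_. 1"]) auto
next
  case (insert j0 J)
  show ?case
  proof (cases "\<forall>i\<in>I. M i j0 = 0")
    case True
    obtain a where "\<exists>i\<in>I. a i \<noteq> 0" "\<forall>j\<in>J. (\<Sum>i\<in>I. a i * M i j) = 0"
      using insert.IH[of I M] insert.prems insert.hyps by auto
    then show ?thesis using True by (intro exI[of _ a]) auto
  next
    case False
    then obtain i0 where i0: "i0 \<in> I" "M i0 j0 \<noteq> 0" by blast
    define I' where "I' = I - {i0}"
    have I: "I = insert i0 I'" "i0 \<notin> I'" "finite I'" using i0 insert.prems by (auto simp: I'_def)
    then have "card J < card I'" using insert.prems insert.hyps by simp
    then obtain a where a: "\<exists>i\<in>I'. a i \<noteq> 0"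
      "\<And>j. j \<in> J \<Longrightarrow> (\<Sum>i\<in>I'. a i * (M i j - M i j0 / M i0 j0 * M i0 j)) = 0"
      using insert.IH[of I' "\<lambda>i j. M i j - M i j0 / M i0 j0 * M i0 j"] I(3) by auto
    \<comment> \<open>Solving equation \<open>j0\<close> for the pivot variable \<open>i0\<close>
      forces this value.\<close>
    define c where "c = - (\<Sum>i\<in>I'. a i * (M i j0 / M i0 j0))"
    have sum: "(\<Sum>i\<in>I. (a(i0 := c)) i * M i j) = c * M i0 j + (\<Sum>i\<in>I'. a i * M i j)" for j
    proof -
      have "(\<Sum>i\<in>I'. (a(i0 := c)) i * M i j) = (\<Sum>i\<in>I'. a i * M i j)"
        using I(2) by (intro sum.cong) auto
      then show ?thesis using I by simp
    qed
    have "(\<Sum>i\<in>I. (a(i0 := c)) i * M i j) = 0" if "j \<in> insert j0 J" for j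
    proof (cases "j = j0")
      case True
      have "(\<Sum>i\<in>I'. a i * (M i j0 / M i0 j0)) * M i0 j0 = (\<Sum>i\<in>I'. a i * M i j0)"
        using i0 by (simp add: sum_distrib_right)
      then show ?thesis unfolding sum True by (simp add: c_def)
    next
      case False
      then have "(\<Sum>i\<in>I'. a i * (M i j - M i j0 / M i0 j0 * M i0 j)) = 0"
        using a(2) that by auto
      also have "(\<Sum>i\<in>I'. a i * (M i j - M i j0 / M i0 j0 * M i0 j))
          = (\<Sum>i\<in>I'. a i * M i j) - (\<Sum>i\<in>I'. a i * (M i j0 / M i0 j0)) * M i0 j"
        by (simp add: right_diff_distrib sum_subtractf sum_distrib_right mult.assoc)
      finally show ?thesis unfolding sum by (simp add: c_def)
    qed
    moreover have "\<exists>i\<in>I. (a(i0 := c)) i \<noteq> 0"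
      using a(1) I(1,2) by (metis fun_upd_other insertI2)
    ultimately show ?thesis by blast
  qed
qed

section \<open>Bases, traces and involutions on finite-dimensional subspaces\<close>

context vector_space
begin

lemma subspace_finite_basis:
  assumes "subspace U" and "U \<subseteq> span B" and "finite B"
  obtains C where "finite C" "independent C" "span C = U" "C \<subseteq> U"
proof -
  obtain C where C: "C \<subseteq> U" "independent C" "U \<subseteq> span C"
    using maximal_independent_subset by blast
  then have "finite C"
    using independent_span_bound[of B C] assms by auto
  moreover have "span C = U"
    using C assms by (simp add: span_subspace)
  ultimately show thesis using C that by blast
qed

text \<open>A basis of \<open>W\<close> extends to a basis of \<open>U\<close>, and the dimension
  bound leaves no room for further vectors.\<close>

lemma subspace_eqI_dim:
  assumes "subspace U" "subspace W" "W \<subseteq> U" "U \<subseteq> span B" "finite B" "dim U \<le> dim W"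
  shows "W = U"
proof -
  obtain C where C: "C \<subseteq> W" "independent C" "W \<subseteq> span C" "card C = dim W"
    using basis_exists by blast
  then have "C \<subseteq> U" using assms(3) by blast
  then obtain D where D: "C \<subseteq> D" "D \<subseteq> U" "independent D" "U \<subseteq> span D"
    using maximal_independent_subset_extend[of C U] C(2) by metis
  have "finite D" using independent_span_bound[of B D] D assms by auto
  moreover have "card D \<le> card C" using basis_card_eq_dim[OF D(2,4,3)] C(4) assms by simp
  ultimately have "C = D" using D(1) by (simp add: card_seteq)
  then show ?thesis
    using C D assms by (metis span_subspace subset_antisym)
qed

text \<open>Writing each \<open>f i\<close> in terms of \<open>B\<close> turns a linear dependence
  into a homogeneous system with one equation per element of \<open>B\<close>.\<close>

lemma sum_scale_nontrivial:
  assumes "finite B" "finite I" "card B < card I" "\<And>i. i \<in> I \<Longrightarrow> f i \<in> span B"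
  obtains a where "\<exists>i\<in>I. a i \<noteq> 0" "(\<Sum>i\<in>I. scale (a i) (f i)) = 0"
proof -
  have "\<forall>i\<in>I. \<exists>u. f i = (\<Sum>b\<in>B. scale (u b) b)"
    using assms by (auto simp: span_finite)
  then obtain u where u: "\<And>i. i \<in> I \<Longrightarrow> f i = (\<Sum>b\<in>B. scale (u i b) b)"
    by metis
  obtain a where a: "\<exists>i\<in>I. a i \<noteq> 0" "\<forall>b\<in>B. (\<Sum>i\<in>I. a i * u i b) = 0"
    using homogeneous_system_nontrivial[OF assms(1-3), of u] by blast
  have "(\<Sum>i\<in>I. scale (a i) (f i)) = (\<Sum>i\<in>I. \<Sum>b\<in>B. scale (a i * u i b) b)"
    by (intro sum.cong) (simp_all add: u scale_sum_right)
  also have "\<dots> = (\<Sum>b\<in>B. scale (\<Sum>i\<in>I. a i * u i b) b)"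
    by (subst sum.swap) (simp add: scale_sum_left)
  also have "\<dots> = 0" using a(2) by simp
  finally show thesis using that a(1) by blast
qed

text \<open>Expanding \<open>b\<close> in \<open>C\<close> on one side and \<open>T c\<close> in
  \<open>B\<close> on the other turns both traces into the same double sum over \<open>B\<close> and
  \<open>C\<close>. Linearity of \<open>T\<close> is asked only on the span, because the action of a
  representation is controlled only there.\<close>

lemma trace_basis_independent:
  assumes B: "finite B" "independent B" and C: "finite C" "independent C" and span: "span C = span B"
    and T: "\<And>x. x \<in> span B \<Longrightarrow> T x \<in> span B"
      "\<And>x y. x \<in> span B \<Longrightarrow> y \<in> span B \<Longrightarrow> T (x + y) = T x + T y"
      "\<And>c x. x \<in> span B \<Longrightarrow> T (scale c x) = scale c (T x)"
  shows "(\<Sum>b\<in>B. representation B (T b) b) = (\<Sum>c\<in>C. representation C (T c) c)"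
proof -
  have T0: "T 0 = 0" using T(3)[of 0 0] by (simp add: span_zero)
  have T_sum: "T (\<Sum>c\<in>A. scale (r c) c) = (\<Sum>c\<in>A. scale (r c) (T c))"
    if "finite A" "A \<subseteq> span B" for A r
    using that by (induction A rule: finite_induct) (auto simp: T T0 span_sum span_scale subset_iff)
  have CB: "C \<subseteq> span B" using span span_superset by blast
  have BC: "B \<subseteq> span C" using span span_superset by blast
  have TC: "\<And>c. c \<in> C \<Longrightarrow> T c \<in> span B" using T(1) CB by blast
  have TB: "\<And>b. b \<in> B \<Longrightarrow> T b \<in> span B" using T(1) span_base by blast
  have 1: "representation B (T b) b = (\<Sum>c\<in>C. representation C b c * representation B (T c) b)"
    if "b \<in> B" for b
  proof -
    have "b = (\<Sum>c\<in>C. scale (representation C b c) c)"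
      using that BC C by (subst sum_representation_eq) auto
    then have "T b = (\<Sum>c\<in>C. scale (representation C b c) (T c))"
      using T_sum[OF C(1) CB] by metis
    then have "representation B (T b) =
        (\<lambda>x. \<Sum>c\<in>C. representation B (scale (representation C b c) (T c)) x)"
      using B TC by (simp add: representation_sum span_scale)
    then show ?thesis using B TC by (simp add: representation_scale)
  qed
  have 2: "representation C (T c) c = (\<Sum>b\<in>B. representation B (T c) b * representation C b c)"
    if "c \<in> C" for c
  proof -
    have "T c = (\<Sum>b\<in>B. scale (representation B (T c) b) b)"
      using that TC B by (subst sum_representation_eq) auto
    then have "representation C (T c) =
        representation C (\<Sum>b\<in>B. scale (representation B (T c) b) b)" by simp
    also have "\<dots> = (\<lambda>x. \<Sum>b\<in>B. representation C (scale (representation B (T c) b) b) x)"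
      using C BC by (intro representation_sum) (auto intro: span_scale)
    finally show ?thesis using C BC by (simp add: representation_scale subset_iff)
  qed
  have "(\<Sum>b\<in>B. representation B (T b) b)
      = (\<Sum>b\<in>B. \<Sum>c\<in>C. representation C b c * representation B (T c) b)"
    using 1 by simp
  also have "\<dots> = (\<Sum>c\<in>C. \<Sum>b\<in>B. representation B (T c) b * representation C b c)"
    by (subst sum.swap) (simp add: mult.commute)
  also have "\<dots> = (\<Sum>c\<in>C. representation C (T c) c)" using 2 by simp
  finally show ?thesis .
qed

text \<open>Since \<open>2\<close> is invertible, \<open>x\<close> is half the sum of
  \<open>x + T x\<close> and \<open>x - T x\<close>, which lie in the two eigenspaces, and these
  meet only in zero. Hence bases of the eigenspaces together form a basis of
  \<open>V\<close>.\<close>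

lemma involution_eigenbasis:
  assumes V: "subspace V" "V \<subseteq> span B" "finite B"
    and T: "\<And>x. x \<in> V \<Longrightarrow> T x \<in> V" "\<And>x. x \<in> V \<Longrightarrow> T (T x) = x"
      "\<And>x y. x \<in> V \<Longrightarrow> y \<in> V \<Longrightarrow> T (x + y) = T x + T y"
      "\<And>c x. x \<in> V \<Longrightarrow> T (scale c x) = scale c (T x)"
    and two: "(2::'a) \<noteq> 0"
  obtains P Q where "finite P" "finite Q" "P \<inter> Q = {}" "independent (P \<union> Q)" "span (P \<union> Q) = V"
    "\<And>x. x \<in> P \<Longrightarrow> T x = x" "\<And>x. x \<in> Q \<Longrightarrow> T x = - x"
proof -
  have neg: "T (- x) = - T x" if "x \<in> V" for x
    using T(4)[OF that, of "-1"] by simp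
  have T0: "T 0 = 0" using T(4)[OF subspace_0[OF V(1)], of 0] by simp
  define Vp where "Vp = {x \<in> V. T x = x}"
  define Vm where "Vm = {x \<in> V. T x = - x}"
  have sub: "subspace Vp" "subspace Vm"
    using V(1) T T0 by (auto simp: subspace_def Vp_def Vm_def)
  moreover have "Vp \<subseteq> span B" "Vm \<subseteq> span B"
    using V(2) by (auto simp: Vp_def Vm_def)
  ultimately obtain P Q where P: "finite P" "independent P" "span P = Vp" "P \<subseteq> Vp"
    and Q: "finite Q" "independent Q" "span Q = Vm" "Q \<subseteq> Vm"
    using subspace_finite_basis[OF _ _ V(3)] by metis
  have eq0: "x = 0" if "x \<in> Vp" "x \<in> Vm" for x
  proof -
    have "x = - x" using that by (simp add: Vp_def Vm_def)
    then have "x + x = 0" by (metis add.left_inverse)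
    then have "scale 2 x = 0" by (metis one_add_one scale_left_distrib scale_one)
    then show ?thesis using two by simp
  qed
  have disj: "P \<inter> Q = {}"
  proof -
    have "0 \<notin> P" using P(2) dependent_zero by blast
    then show ?thesis using eq0 P(4) Q(4) by blast
  qed
  have ind: "independent (P \<union> Q)"
  proof (rule independent_if_scalars_zero)
    fix f x assume "(\<Sum>x\<in>P \<union> Q. scale (f x) x) = 0" and x: "x \<in> P \<union> Q"
    then have "(\<Sum>x\<in>P. scale (f x) x) + (\<Sum>x\<in>Q. scale (f x) x) = 0"
      using P(1) Q(1) disj by (simp add: sum.union_disjoint)
    then have eq: "(\<Sum>x\<in>P. scale (f x) x) = - (\<Sum>x\<in>Q. scale (f x) x)"
      by (simp only: eq_neg_iff_add_eq_0)
    have "(\<Sum>x\<in>P. scale (f x) x) \<in> Vp" "(\<Sum>x\<in>Q. scale (f x) x) \<in> Vm"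
      using P(4) Q(4) sub by (auto intro!: subspace_sum subspace_scale)
    then have "(\<Sum>x\<in>P. scale (f x) x) = 0"
      by (intro eq0) (simp_all add: eq subspace_neg[OF sub(2)])
    moreover from this have "(\<Sum>x\<in>Q. scale (f x) x) = 0"
      using eq by simp
    ultimately have "(\<Sum>x\<in>P. scale (f x) x) = 0" "(\<Sum>x\<in>Q. scale (f x) x) = 0" by auto
    then show "f x = 0"
      using x independentD[OF P(2,1) subset_refl] independentD[OF Q(2,1) subset_refl] by blast
  qed (use P Q in simp)
  have "span (P \<union> Q) = V"
  proof
    show "span (P \<union> Q) \<subseteq> V"
      using V(1) P(4) Q(4) by (intro span_minimal) (auto simp: Vp_def Vm_def)
    show "V \<subseteq> span (P \<union> Q)"
    proof
      fix x assume x: "x \<in> V"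
      have "T (x + T x) = x + T x"
        using x T(3)[of x "T x"] T(1,2)[OF x] by (simp add: add.commute)
      moreover have "T (x - T x) = - (x - T x)"
        using x T(3)[of x "- T x"] T(1,2)[OF x] neg[of "T x"] subspace_neg[OF V(1)] by simp
      ultimately have "x + T x \<in> Vp" "x - T x \<in> Vm"
        using x T(1)[OF x] V(1) by (simp_all add: Vp_def Vm_def subspace_add subspace_diff)
      then have "x + T x \<in> span (P \<union> Q)" "x - T x \<in> span (P \<union> Q)"
        using P(3) Q(3) span_mono[of P "P \<union> Q"] span_mono[of Q "P \<union> Q"] by auto
      then have "(x + T x) + (x - T x) \<in> span (P \<union> Q)" by (rule span_add)
      also have "(x + T x) + (x - T x) = scale 2 x"
        using scale_left_distrib[of 1 1 x] by simp
      finally have "scale 2 x \<in> span (P \<union> Q)" .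
      then have "scale (inverse 2) (scale 2 x) \<in> span (P \<union> Q)" by (rule span_scale)
      then show "x \<in> span (P \<union> Q)" using two by simp
    qed
  qed
  then show thesis
    using that[of P Q] P Q disj ind by (auto simp: Vp_def Vm_def)
qed

end

text \<open>Induction on the degree bound. A root \<open>z\<close> splits off a factor: p = (X - z)
  q. Either \<open>T x = s z x\<close>, or \<open>y = T x - s z x\<close> is a nonzero vector
  annihilated by \<open>q\<close>, which has smaller degree.\<close>

lemma eigenvector_of_annihilating_poly:
  fixes s :: "complex \<Rightarrow> 'v::ab_group_add \<Rightarrow> 'v"
  assumes "vector_space s" and V: "Modules.module.subspace s V"
    and T: "\<And>x. x \<in> V \<Longrightarrow> T x \<in> V"
      "\<And>x y. x \<in> V \<Longrightarrow> y \<in> V \<Longrightarrow> T (x + y) = T x + T y"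
      "\<And>c x. x \<in> V \<Longrightarrow> T (s c x) = s c (T x)"
  assumes "degree p \<le> n" "p \<noteq> 0" "x \<in> V" "x \<noteq> 0" "(\<Sum>i\<le>n. s (coeff p i) ((T ^^ i) x)) = 0"
  shows "\<exists>c. \<exists>y\<in>V. y \<noteq> 0 \<and> T y = s c y"
proof -
  interpret vector_space s by fact
  have TV: "(T ^^ i) x \<in> V" if "x \<in> V" for i x
    using that T(1) by (induction i) auto
  have Tdiff: "(T ^^ i) (x - s c y) = (T ^^ i) x - s c ((T ^^ i) y)"
    if "x \<in> V" "y \<in> V" for i x y c
  proof (induction i)
    case (Suc i)
    have "T ((T ^^ i) x + s (- c) ((T ^^ i) y)) = T ((T ^^ i) x) + s (- c) (T ((T ^^ i) y))"
      using T(2,3) TV that subspace_scale[OF V] by metis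
    then show ?case using Suc by simp
  qed simp
  show ?thesis using assms(6-10)
  proof (induction n arbitrary: p x)
    case 0
    then show ?case using leading_coeff_0_iff[of p] by simp
  next
    case (Suc n)
    show ?case
    proof (cases "degree p = 0")
      case True
      have "(\<Sum>i\<le>Suc n. s (coeff p i) ((T ^^ i) x)) = (\<Sum>i\<in>{0}. s (coeff p i) ((T ^^ i) x))"
        by (rule sum.mono_neutral_right) (auto simp: True coeff_eq_0)
      then show ?thesis using Suc.prems True leading_coeff_0_iff[of p] by simp
    next
      case False
      then obtain z where "poly p z = 0"
        using fundamental_theorem_of_algebra_alt[of p] by (metis degree_pCons_0)
      then obtain q where q: "p = [:- z, 1:] * q" by (metis dvdE poly_eq_0_iff_dvd)
      then have q0: "q \<noteq> 0" using Suc.prems by auto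
      have deg: "degree p = Suc (degree q)" unfolding q using q0 by (subst degree_mult_eq) auto
      define y where "y = T x - s z x"
      have yV: "y \<in> V"
        using Suc.prems V T(1) by (simp add: y_def subspace_diff subspace_scale)
      show ?thesis
      proof (cases "y = 0")
        case True
        then show ?thesis using Suc.prems by (auto simp: y_def)
      next
        case False
        have coeff: "coeff p i = (case i of 0 \<Rightarrow> 0 | Suc j \<Rightarrow> coeff q j) - z * coeff q i" for i
          by (simp add: q coeff_pCons split: nat.splits)
        \<comment> \<open>Multiplying \<open>q\<close> by X raises every power of \<open>T\<close>
          by one, so only the index 0 term, with coefficient zero, is lost in the shift.\<close>
        have 1: "(\<Sum>i\<le>Suc n. s (case i of 0 \<Rightarrow> 0 | Suc j \<Rightarrow> coeff q j) ((T ^^ i) x))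
            = (\<Sum>i\<le>n. s (coeff q i) ((T ^^ i) (T x)))"
          by (simp add: sum.atMost_Suc_shift funpow_Suc_right del: funpow.simps sum.atMost_Suc)
        \<comment> \<open>The summand at \<open>Suc n\<close> vanishes because \<open>q\<close> has
          smaller degree than \<open>p\<close>.\<close>
        have 2: "(\<Sum>i\<le>Suc n. s (z * coeff q i) ((T ^^ i) x))
            = (\<Sum>i\<le>n. s (coeff q i) (s z ((T ^^ i) x)))"
          using deg Suc.prems(1) by (simp add: coeff_eq_0 mult.commute)
        have "(\<Sum>i\<le>n. s (coeff q i) ((T ^^ i) y))
            = (\<Sum>i\<le>n. s (coeff q i) ((T ^^ i) (T x))) - (\<Sum>i\<le>n. s (coeff q i) (s z ((T ^^ i) x)))"
          using Suc.prems T(1) by (simp only: y_def Tdiff scale_right_diff_distrib sum_subtractf)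
        also have "\<dots> = (\<Sum>i\<le>Suc n. s (coeff p i) ((T ^^ i) x))"
          unfolding 1[symmetric] 2[symmetric] coeff
          by (simp only: scale_left_diff_distrib sum_subtractf)
        finally show ?thesis
          using Suc.IH[of q y] Suc.prems deg q0 yV False by simp
      qed
    qed
  qed
qed

text \<open>The \<open>card B + 1\<close> vectors obtained from \<open>x\<close> by the powers of
  \<open>T\<close> up to \<open>card B\<close> are dependent. The coefficients of a dependence form
  a nonzero polynomial in \<open>T\<close> that annihilates \<open>x\<close>.\<close>

lemma exists_eigenvector:
  fixes s :: "complex \<Rightarrow> 'v::ab_group_add \<Rightarrow> 'v"
  assumes "vector_space s" and V: "V = Modules.module.span s B" "finite B" "V \<noteq> {0}"
    and T: "\<And>x. x \<in> V \<Longrightarrow> T x \<in> V"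
      "\<And>x y. x \<in> V \<Longrightarrow> y \<in> V \<Longrightarrow> T (x + y) = T x + T y"
      "\<And>c x. x \<in> V \<Longrightarrow> T (s c x) = s c (T x)"
  shows "\<exists>c. \<exists>y\<in>V. y \<noteq> 0 \<and> T y = s c y"
proof -
  interpret vector_space s by fact
  have sub: "subspace V" by (simp add: V)
  then obtain x where x: "x \<in> V" "x \<noteq> 0" using V(3) subspace_0 by blast
  have TV: "(T ^^ i) x \<in> span B" for i
    using x(1) T(1) by (induction i) (auto simp: V)
  obtain a where a: "\<exists>i\<in>{..card B}. a i \<noteq> 0" "(\<Sum>i\<le>card B. s (a i) ((T ^^ i) x)) = 0"
    using sum_scale_nontrivial[of B "{..card B}" "\<lambda>i. (T ^^ i) x"] V TV by auto
  define p where "p = (\<Sum>i\<le>card B. monom (a i) i)"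
  have coeff: "coeff p i = (if i \<le> card B then a i else 0)" for i
    by (simp add: p_def coeff_sum)
  have "p \<noteq> 0" using a(1) coeff by (metis atMost_iff coeff_0)
  moreover have "degree p \<le> card B" by (rule degree_le) (simp add: coeff)
  moreover have "(\<Sum>i\<le>card B. s (coeff p i) ((T ^^ i) x)) = 0"
    using a(2) by (simp add: coeff)
  ultimately show ?thesis
    using eigenvector_of_annihilating_poly[OF assms(1) sub T, of p "card B" x] x by blast
qed

section \<open>Homomorphisms of representations\<close>

text \<open>The linearity and equivariance clauses of \<open>rep_iso\<close> without bijectivity, so
  that Schur's lemma can be applied to maps not yet known to be isomorphisms.\<close>

definition rep_hom ::
  "('g, 'm) monoid_scheme \<Rightarrow> ('g, 'v::ab_group_add) cplx_rep \<Rightarrow>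
   ('g, 'u::ab_group_add) cplx_rep \<Rightarrow> ('v \<Rightarrow> 'u) \<Rightarrow> bool" where
  "rep_hom G R L f \<longleftrightarrow>
     (\<forall>x\<in>vecs R. f x \<in> vecs L) \<and>
     (\<forall>x\<in>vecs R. \<forall>y\<in>vecs R. f (x + y) = f x + f y) \<and>
     (\<forall>c. \<forall>x\<in>vecs R. f (scal R c x) = scal L c (f x)) \<and>
     (\<forall>g\<in>carrier G. \<forall>x\<in>vecs R. f (act R g x) = act L g (f x))"

lemma rep_homI:
  assumes "\<And>x. x \<in> vecs R \<Longrightarrow> f x \<in> vecs L"
    and "\<And>x y. x \<in> vecs R \<Longrightarrow> y \<in> vecs R \<Longrightarrow> f (x + y) = f x + f y"
    and "\<And>c x. x \<in> vecs R \<Longrightarrow> f (scal R c x) = scal L c (f x)"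
    and "\<And>g x. g \<in> carrier G \<Longrightarrow> x \<in> vecs R \<Longrightarrow> f (act R g x) = act L g (f x)"
  shows "rep_hom G R L f"
  using assms by (simp add: rep_hom_def)

lemma rep_homD:
  assumes "rep_hom G R L f"
  shows rep_hom_closed: "x \<in> vecs R \<Longrightarrow> f x \<in> vecs L"
    and rep_hom_add: "x \<in> vecs R \<Longrightarrow> y \<in> vecs R \<Longrightarrow> f (x + y) = f x + f y"
    and rep_hom_scal: "x \<in> vecs R \<Longrightarrow> f (scal R c x) = scal L c (f x)"
    and rep_hom_act: "g \<in> carrier G \<Longrightarrow> x \<in> vecs R \<Longrightarrow> f (act R g x) = act L g (f x)"
  using assms by (auto simp: rep_hom_def)

lemma rep_iso_iff_rep_hom:
  "rep_iso G R L \<longleftrightarrow> (\<exists>f. rep_hom G R L f \<and> bij_betw f (vecs R) (vecs L))"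
  by (auto simp: rep_iso_def rep_hom_def bij_betw_def)

section \<open>Basic properties of representations, submodules and homomorphisms\<close>

lemma is_repD:
  assumes "is_rep G R"
  shows is_rep_vector_space: "vector_space (scal R)"
    and is_rep_finite_span: "\<exists>B. finite B \<and> vecs R = Modules.module.span (scal R) B"
    and is_rep_act_closed: "g \<in> carrier G \<Longrightarrow> x \<in> vecs R \<Longrightarrow> act R g x \<in> vecs R"
    and is_rep_act_add:
      "g \<in> carrier G \<Longrightarrow> x \<in> vecs R \<Longrightarrow> y \<in> vecs R \<Longrightarrow> act R g (x + y) = act R g x + act R g y"
    and is_rep_act_scal:
      "g \<in> carrier G \<Longrightarrow> x \<in> vecs R \<Longrightarrow> act R g (scal R c x) = scal R c (act R g x)"
    and is_rep_act_one: "x \<in> vecs R \<Longrightarrow> act R \<one>\<^bsub>G\<^esub> x = x"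
    and is_rep_act_mult: "g \<in> carrier G \<Longrightarrow> h \<in> carrier G \<Longrightarrow> x \<in> vecs R \<Longrightarrow>
      act R (g \<otimes>\<^bsub>G\<^esub> h) x = act R g (act R h x)"
  using assms by (auto simp: is_rep_def)

lemma is_rep_subspace:
  assumes "is_rep G R"
  shows "Modules.module.subspace (scal R) (vecs R)"
proof -
  interpret vector_space "scal R" by (rule is_rep_vector_space[OF assms])
  show ?thesis using is_rep_finite_span[OF assms] by auto
qed

lemma subrep_simps [simp]:
  "scal (subrep R U) = scal R" "vecs (subrep R U) = U" "act (subrep R U) = act R"
  by (simp_all add: subrep_def)

lemma is_submoduleD:
  assumes "is_submodule G R U"
  shows is_submodule_subset: "U \<subseteq> vecs R"
    and is_submodule_subspace: "Modules.module.subspace (scal R) U"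
    and is_submodule_act: "g \<in> carrier G \<Longrightarrow> x \<in> U \<Longrightarrow> act R g x \<in> U"
  using assms by (auto simp: is_submodule_def is_subspace_def)

lemma is_submodule_subrep_iff:
  "W \<subseteq> U \<Longrightarrow> U \<subseteq> vecs R \<Longrightarrow> is_submodule G (subrep R U) W \<longleftrightarrow> is_submodule G R W"
  by (auto simp: is_submodule_def is_subspace_def)

lemma is_rep_subrep:
  assumes R: "is_rep G R" and U: "is_submodule G R U"
  shows "is_rep G (subrep R U)"
proof -
  interpret vector_space "scal R" by (rule is_rep_vector_space[OF R])
  obtain B where "finite B" "vecs R = span B" using is_rep_finite_span[OF R] by blast
  then obtain C where "finite C" "span C = U"
    using subspace_finite_basis[OF is_submodule_subspace[OF U], of B] is_submodule_subset[OF U]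
    by blast
  then show ?thesis
    using R U unfolding is_rep_def is_submodule_def subrep_simps by (blast dest: subsetD)
qed

lemma rep_hom_sum:
  assumes R: "is_rep G R" and L: "is_rep G L" and f: "rep_hom G R L f"
    and "finite I" "\<And>i. i \<in> I \<Longrightarrow> x i \<in> vecs R"
  shows "f (\<Sum>i\<in>I. scal R (c i) (x i)) = (\<Sum>i\<in>I. scal L (c i) (f (x i)))"
proof -
  interpret R: vector_space "scal R" by (rule is_rep_vector_space[OF R])
  interpret L: vector_space "scal L" by (rule is_rep_vector_space[OF L])
  have "f (scal R 0 0) = scal L 0 (f 0)"
    by (rule rep_hom_scal[OF f]) (rule R.subspace_0[OF is_rep_subspace[OF R]])
  then have 0: "f 0 = 0" by simp
  show ?thesis
    using assms(4,5)
  proof (induction I rule: finite_induct)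
    case (insert i I)
    have "(\<Sum>i\<in>I. scal R (c i) (x i)) \<in> vecs R" "scal R (c i) (x i) \<in> vecs R"
      using insert.prems is_rep_subspace[OF R]
      by (auto intro!: R.subspace_sum R.subspace_scale)
    then show ?case
      using insert by (simp add: rep_hom_add[OF f] rep_hom_scal[OF f])
  qed (simp add: 0)
qed

lemma rep_hom_zero:
  assumes "is_rep G R" "is_rep G L" "rep_hom G R L f"
  shows "f 0 = 0"
  using rep_hom_sum[OF assms, of "{}"] by simp

lemma rep_hom_diff:
  assumes R: "is_rep G R" and L: "is_rep G L" and f: "rep_hom G R L f"
    and x: "x \<in> vecs R" "y \<in> vecs R"
  shows "f (x - y) = f x - f y"
proof -
  interpret R: vector_space "scal R" by (rule is_rep_vector_space[OF R])
  have "f ((x - y) + y) = f (x - y) + f y"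
    using x R.subspace_diff[OF is_rep_subspace[OF R]] by (intro rep_hom_add[OF f]) auto
  then show ?thesis by (simp add: algebra_simps)
qed

lemma rep_hom_comp:
  assumes "rep_hom G R L f" "rep_hom G L M h"
  shows "rep_hom G R M (\<lambda>x. h (f x))"
  using assms by (auto simp: rep_hom_def)

lemma rep_hom_inv_into:
  assumes R: "is_rep G R" and f: "rep_hom G R L f" and bij: "bij_betw f (vecs R) (vecs L)"
  shows "rep_hom G L R (inv_into (vecs R) f)"
proof -
  interpret R: vector_space "scal R" by (rule is_rep_vector_space[OF R])
  let ?h = "inv_into (vecs R) f"
  have h: "?h y \<in> vecs R" "f (?h y) = y" if "y \<in> vecs L" for y
    using that bij by (auto simp: bij_betw_def inv_into_into f_inv_into_f)
  have inv: "?h (f x) = x" if "x \<in> vecs R" for x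
    using that bij by (simp add: bij_betw_def inv_into_f_f)
  note sub = is_rep_subspace[OF R]
  show ?thesis
  proof (rule rep_homI)
    fix x y assume "x \<in> vecs L" "y \<in> vecs L"
    then show "?h (x + y) = ?h x + ?h y"
      using inv[of "?h x + ?h y"] h R.subspace_add[OF sub] by (simp add: rep_hom_add[OF f])
  next
    fix c x assume "x \<in> vecs L"
    then show "?h (scal L c x) = scal R c (?h x)"
      using inv[of "scal R c (?h x)"] h R.subspace_scale[OF sub] by (simp add: rep_hom_scal[OF f])
  next
    fix g x assume "g \<in> carrier G" "x \<in> vecs L"
    then show "?h (act L g x) = act R g (?h x)"
      using inv[of "act R g (?h x)"] h is_rep_act_closed[OF R] by (simp add: rep_hom_act[OF f])
  qed (rule h)
qed

lemma rep_iso_sym: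
  assumes "is_rep G R" "rep_iso G R L"
  shows "rep_iso G L R"
  using assms rep_hom_inv_into bij_betw_inv_into unfolding rep_iso_iff_rep_hom by blast

section \<open>Irreducible representations and Schur's lemma\<close>

lemma irreducible_repD:
  assumes "irreducible_rep G R"
  shows irreducible_is_rep: "is_rep G R"
    and irreducible_nonzero: "vecs R \<noteq> {0}"
    and irreducible_submodule: "is_submodule G R U \<Longrightarrow> U = {0} \<or> U = vecs R"
  using assms by (auto simp: irreducible_rep_def)

text \<open>The kernel is a submodule other than \<open>vecs R\<close>, hence zero; the image is a
  nonzero submodule, hence all of \<open>vecs L\<close>.\<close>

lemma schur_bij:
  assumes "irreducible_rep G R" "irreducible_rep G L" and f: "rep_hom G R L f"
    and nz: "\<exists>x\<in>vecs R. f x \<noteq> 0"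
  shows "bij_betw f (vecs R) (vecs L)"
proof -
  note R = irreducible_is_rep[OF assms(1)] and L = irreducible_is_rep[OF assms(2)]
  interpret R: vector_space "scal R" by (rule is_rep_vector_space[OF R])
  interpret L: vector_space "scal L" by (rule is_rep_vector_space[OF L])
  note subR = is_rep_subspace[OF R] and subL = is_rep_subspace[OF L]
  have 0: "f 0 = 0" by (rule rep_hom_zero[OF R L f])
  have act0: "act L g 0 = 0" if "g \<in> carrier G" for g
    using is_rep_act_scal[OF L that L.subspace_0[OF subL], of 0] by simp
  have "is_submodule G R {x \<in> vecs R. f x = 0}"
    unfolding is_submodule_def is_subspace_def
  proof (intro conjI ballI)
    show "R.subspace {x \<in> vecs R. f x = 0}"
      using subR 0 by (auto simp: R.subspace_def rep_hom_add[OF f] rep_hom_scal[OF f])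
  qed (auto simp: is_rep_act_closed[OF R] rep_hom_act[OF f] act0)
  then have "{x \<in> vecs R. f x = 0} = {0}"
    using irreducible_submodule[OF assms(1)] nz by blast
  then have "inj_on f (vecs R)"
    using R.subspace_diff[OF subR] rep_hom_diff[OF R L f]
    by (intro inj_onI) (metis (mono_tags, lifting) eq_iff_diff_eq_0 mem_Collect_eq singletonD)
  moreover have "is_submodule G L (f ` vecs R)"
    unfolding is_submodule_def is_subspace_def
  proof (intro conjI ballI)
    show "L.subspace (f ` vecs R)"
    proof (rule L.subspaceI)
      show "0 \<in> f ` vecs R" using 0 R.subspace_0[OF subR] by force
    next
      fix x y assume "x \<in> f ` vecs R" "y \<in> f ` vecs R"
      then show "x + y \<in> f ` vecs R"
        using rep_hom_add[OF f, symmetric] R.subspace_add[OF subR] by auto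
    next
      fix c x assume "x \<in> f ` vecs R"
      then show "scal L c x \<in> f ` vecs R"
        using rep_hom_scal[OF f, symmetric] R.subspace_scale[OF subR] by auto
    qed
  next
    fix g x assume "g \<in> carrier G" "x \<in> f ` vecs R"
    then show "act L g x \<in> f ` vecs R"
      using rep_hom_act[OF f, symmetric] is_rep_act_closed[OF R] by auto
  qed (use rep_hom_closed[OF f] in auto)
  then have "f ` vecs R = vecs L"
    using irreducible_submodule[OF assms(2)] nz by blast
  ultimately show ?thesis by (simp add: bij_betw_def)
qed

text \<open>Over the complex numbers \<open>f\<close> has an eigenvector; the eigenspace is a
  nonzero submodule, hence everything.\<close>

lemma schur_endomorphism:
  assumes "irreducible_rep G R" and f: "rep_hom G R R f"
  shows "\<exists>c. \<forall>x\<in>vecs R. f x = scal R c x"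
proof -
  note R = irreducible_is_rep[OF assms(1)]
  interpret R: vector_space "scal R" by (rule is_rep_vector_space[OF R])
  note subR = is_rep_subspace[OF R]
  obtain B where B: "finite B" "vecs R = R.span B" using is_rep_finite_span[OF R] by blast
  have "\<exists>c. \<exists>y\<in>vecs R. y \<noteq> 0 \<and> f y = scal R c y"
    by (rule exists_eigenvector[OF R.vector_space_axioms B(2,1) irreducible_nonzero[OF assms(1)]])
      (simp_all add: rep_hom_closed[OF f] rep_hom_add[OF f] rep_hom_scal[OF f])
  then obtain c y where y: "y \<in> vecs R" "y \<noteq> 0" "f y = scal R c y" by blast
  have "is_submodule G R {x \<in> vecs R. f x = scal R c x}"
    unfolding is_submodule_def is_subspace_def
  proof (intro conjI ballI)
    show "R.subspace {x \<in> vecs R. f x = scal R c x}"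
      using subR rep_hom_zero[OF R R f]
      by (auto simp: R.subspace_def rep_hom_add[OF f] rep_hom_scal[OF f] R.scale_right_distrib
          R.scale_left_commute)
  qed (auto simp: is_rep_act_closed[OF R] rep_hom_act[OF f] is_rep_act_scal[OF R])
  then have "{x \<in> vecs R. f x = scal R c x} = vecs R"
    using irreducible_submodule[OF assms(1)] y by blast
  then show ?thesis by blast
qed

text \<open>Composing \<open>f\<close> with the inverse of the isomorphism \<open>h\<close> gives an
  endomorphism of \<open>R\<close>, which is a scalar.\<close>

lemma schur_scalar:
  assumes "irreducible_rep G R" "is_rep G L" and f: "rep_hom G R L f"
    and h: "rep_hom G R L h" "bij_betw h (vecs R) (vecs L)"
  shows "\<exists>c. \<forall>x\<in>vecs R. f x = scal L c (h x)"
proof -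
  let ?k = "inv_into (vecs R) h"
  have "rep_hom G R R (\<lambda>x. ?k (f x))"
    using rep_hom_comp[OF f rep_hom_inv_into[OF irreducible_is_rep[OF assms(1)] h]] .
  then obtain c where c: "\<And>x. x \<in> vecs R \<Longrightarrow> ?k (f x) = scal R c x"
    using schur_endomorphism[OF assms(1)] by blast
  have "f x = scal L c (h x)" if "x \<in> vecs R" for x
  proof -
    have "f x = h (?k (f x))"
      using h(2) rep_hom_closed[OF f that] by (simp add: bij_betw_def f_inv_into_f)
    then show ?thesis using c[OF that] rep_hom_scal[OF h(1) that] by simp
  qed
  then show ?thesis by blast
qed

text \<open>A nonzero submodule of \<open>W\<close> of least dimension is irreducible, because a
  nonzero submodule of it has the same dimension and so equals it.\<close>

lemma exists_irreducible_submodule: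
  assumes R: "is_rep G R" and W: "is_submodule G R W" "W \<noteq> {0}"
  shows "\<exists>U\<subseteq>W. is_submodule G R U \<and> irreducible_rep G (subrep R U)"
proof -
  interpret R: vector_space "scal R" by (rule is_rep_vector_space[OF R])
  obtain B where B: "finite B" "vecs R = R.span B" using is_rep_finite_span[OF R] by blast
  let ?P = "\<lambda>U. U \<subseteq> W \<and> is_submodule G R U \<and> U \<noteq> {0}"
  obtain U where U: "?P U" and min: "\<And>U'. ?P U' \<Longrightarrow> R.dim U \<le> R.dim U'"
    using ex_has_least_nat[of ?P W R.dim] W by blast
  have UV: "U \<subseteq> vecs R" using U is_submodule_subset by blast
  have "irreducible_rep G (subrep R U)"
    unfolding irreducible_rep_def
  proof (intro conjI allI impI)
    show "is_rep G (subrep R U)" using is_rep_subrep[OF R] U by blast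
    fix U' assume U': "is_submodule G (subrep R U) U'"
    then have sub: "U' \<subseteq> U" by (auto simp: is_submodule_def)
    then have sm: "is_submodule G R U'" using U' is_submodule_subrep_iff[OF _ UV] by blast
    show "U' = {0} \<or> U' = vecs (subrep R U)"
    proof (cases "U' = {0}")
      case False
      then have "R.dim U \<le> R.dim U'" using min sub sm U by blast
      then have "U' = U"
        using R.subspace_eqI_dim[of U U' B] U sm sub UV B
        by (auto dest!: is_submodule_subspace)
      then show ?thesis by simp
    qed simp
  qed (use U in simp)
  then show ?thesis using U by blast
qed

section \<open>Characters as traces, and their values at involutions\<close>

lemma rep_character_eq_trace:
  assumes R: "is_rep G R" and g: "g \<in> carrier G"
    and B: "\<not> Modules.module.dependent (scal R) B" "Modules.module.span (scal R) B = vecs R"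
  shows "rep_character R g = (\<Sum>b\<in>B. Modules.module.representation (scal R) B (act R g b) b)"
proof -
  interpret R: vector_space "scal R" by (rule is_rep_vector_space[OF R])
  obtain E where E: "finite E" "vecs R = R.span E" using is_rep_finite_span[OF R] by blast
  \<comment> \<open>The comparison of traces asks for finite bases; finiteness comes from the finite
    spanning set \<open>E\<close>.\<close>
  have fin: "finite C" if "R.independent C" "R.span C = vecs R" for C
    using R.independent_span_bound[of E C] that E R.span_superset by metis
  define C where "C = (SOME B. R.independent B \<and> R.span B = vecs R)"
  have C: "R.independent C" "R.span C = vecs R"
    using someI_ex[of "\<lambda>B. R.independent B \<and> R.span B = vecs R"] B unfolding C_def by blast+
  have "(\<Sum>c\<in>C. R.representation C (act R g c) c) = (\<Sum>b\<in>B. R.representation B (act R g b) b)"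
    by (rule R.trace_basis_independent)
      (use B C fin g is_rep_act_closed[OF R] is_rep_act_add[OF R] is_rep_act_scal[OF R] in auto)
  then show ?thesis by (simp add: rep_character_def C_def Let_def)
qed

text \<open>In a basis of eigenvectors of \<open>g\<close> the diagonal coefficients are 1 on
  \<open>P\<close> and -1 on \<open>Q\<close>.\<close>

lemma rep_character_involution:
  assumes R: "is_rep G R" and g: "g \<in> carrier G" "g \<otimes>\<^bsub>G\<^esub> g = \<one>\<^bsub>G\<^esub>"
  obtains P Q where "finite P" "finite Q" "P \<inter> Q = {}"
    "\<not> Modules.module.dependent (scal R) (P \<union> Q)"
    "Modules.module.span (scal R) (P \<union> Q) = vecs R"
    "\<And>x. x \<in> P \<Longrightarrow> act R g x = x" "\<And>x. x \<in> Q \<Longrightarrow> act R g x = - x"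
    "rep_character R g = of_nat (card P) - of_nat (card Q)"
proof -
  interpret R: vector_space "scal R" by (rule is_rep_vector_space[OF R])
  obtain E where E: "finite E" "vecs R = R.span E" using is_rep_finite_span[OF R] by blast
  have invol: "act R g (act R g x) = x" if "x \<in> vecs R" for x
    using is_rep_act_mult[OF R g(1) g(1) that] g(2) is_rep_act_one[OF R that] by simp
  obtain P Q where PQ: "finite P" "finite Q" "P \<inter> Q = {}" "R.independent (P \<union> Q)"
    "R.span (P \<union> Q) = vecs R"
    "\<And>x. x \<in> P \<Longrightarrow> act R g x = x" "\<And>x. x \<in> Q \<Longrightarrow> act R g x = - x"
    by (rule R.involution_eigenbasis[of "vecs R" E "act R g"])
      (use E g is_rep_subspace[OF R] is_rep_act_closed[OF R] is_rep_act_add[OF R]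
        is_rep_act_scal[OF R] invol in auto)
  have "rep_character R g = (\<Sum>b\<in>P \<union> Q. R.representation (P \<union> Q) (act R g b) b)"
    by (rule rep_character_eq_trace[OF R g(1) PQ(4,5)])
  also have "\<dots> = (\<Sum>b\<in>P. R.representation (P \<union> Q) (act R g b) b)
      + (\<Sum>b\<in>Q. R.representation (P \<union> Q) (act R g b) b)"
    using PQ(1-3) by (rule sum.union_disjoint)
  also have "(\<Sum>b\<in>P. R.representation (P \<union> Q) (act R g b) b) = (\<Sum>b\<in>P. 1)"
    by (rule sum.cong) (simp_all add: PQ(4,6) R.representation_basis)
  also have "(\<Sum>b\<in>Q. R.representation (P \<union> Q) (act R g b) b) = (\<Sum>b\<in>Q. - 1)"
    by (rule sum.cong) (simp_all add: PQ(4,7) R.representation_basis R.representation_neg R.span_base)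
  finally show thesis using that PQ by simp
qed

text \<open>\<open>P U x\<close> is the component of \<open>x\<close> in \<open>U\<close>. Sums,
  multiples and translates of components are again families of components, so uniqueness makes the
  projections linear and equivariant.\<close>

lemma decomposition_projections:
  fixes R :: "('g, 'v::ab_group_add) cplx_rep"
  assumes R: "is_rep G R" and D: "orthogonal_decomposition G R \<beta> D"
  obtains P where "\<And>U. U \<in> D \<Longrightarrow> rep_hom G R (subrep R U) (P U)"
    "\<And>x. x \<in> vecs R \<Longrightarrow> x = (\<Sum>U\<in>D. P U x)"
proof -
  interpret vector_space "scal R" by (rule is_rep_vector_space[OF R])
  note sub = is_rep_subspace[OF R]
  have fin: "finite D" and sm: "\<And>U. U \<in> D \<Longrightarrow> is_submodule G R U"
    and ex1: "\<And>x. x \<in> vecs R \<Longrightarrow> \<exists>!u. u \<in> (\<Pi>\<^sub>E U\<in>D. U) \<and> x = (\<Sum>U\<in>D. u U)"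
    using D by (auto simp: orthogonal_decomposition_def)
  note subU = is_submodule_subspace[OF sm]
  define P where "P U x = (THE u. u \<in> (\<Pi>\<^sub>E U\<in>D. U) \<and> x = (\<Sum>U\<in>D. u U)) U" for U x
  have P: "(\<lambda>U. P U x) \<in> (\<Pi>\<^sub>E U\<in>D. U) \<and> x = (\<Sum>U\<in>D. P U x)" if "x \<in> vecs R" for x
    unfolding P_def by (rule theI'[OF ex1[OF that]])
  then have PU: "P U x \<in> U" if "x \<in> vecs R" "U \<in> D" for x U
    using that by auto
  have P_eq: "P U x = v U" if x: "x \<in> vecs R" and v: "\<And>U. U \<in> D \<Longrightarrow> v U \<in> U"
    and eq: "x = (\<Sum>U\<in>D. v U)" and U: "U \<in> D" for x v U
  proof -
    \<comment> \<open>The unique family is \<open>undefined\<close> outside of \<open>D\<close>, so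
      \<open>v\<close> has to be cut down to \<open>D\<close> before uniqueness applies.\<close>
    have "restrict v D \<in> (\<Pi>\<^sub>E U\<in>D. U) \<and> x = (\<Sum>U\<in>D. restrict v D U)"
      using v eq by auto
    then have "(\<lambda>U. P U x) = restrict v D"
      using ex1[OF x] P[OF x] by blast
    then show ?thesis using U by (metis restrict_apply')
  qed
  have hom: "rep_hom G R (subrep R U) (P U)" if U: "U \<in> D" for U
  proof (rule rep_homI)
    fix x y assume xy: "x \<in> vecs R" "y \<in> vecs R"
    show "P U (x + y) = P U x + P U y"
    proof (rule P_eq)
      have "x + y = (\<Sum>U\<in>D. P U x) + (\<Sum>U\<in>D. P U y)" using P xy by simp
      then show "x + y = (\<Sum>U\<in>D. P U x + P U y)" by (simp only: sum.distrib)
    qed (use xy U PU subspace_add[OF sub] subspace_add[OF subU] in auto)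
  next
    fix c x assume x: "x \<in> vecs R"
    show "P U (scal R c x) = scal (subrep R U) c (P U x)"
      unfolding subrep_simps
    proof (rule P_eq)
      have "scal R c x = scal R c (\<Sum>U\<in>D. P U x)" using P x by simp
      then show "scal R c x = (\<Sum>U\<in>D. scal R c (P U x))" by (simp only: scale_sum_right)
    qed (use x U PU subspace_scale[OF sub] subspace_scale[OF subU] in auto)
  next
    fix g x assume g: "g \<in> carrier G" and x: "x \<in> vecs R"
    have act_sum: "act R g (\<Sum>U\<in>E. P U x) = (\<Sum>U\<in>E. act R g (P U x))" if "E \<subseteq> D" for E
      using finite_subset[OF that fin] that
    proof (induction E rule: finite_induct)
      case empty
      show ?case using is_rep_act_scal[OF R g x, of 0] is_rep_act_scal[OF R g subspace_0[OF sub], of 0]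
        by simp
    next
      case (insert U E)
      then have "P U x \<in> vecs R" "(\<Sum>U\<in>E. P U x) \<in> vecs R"
        using PU[OF x] is_submodule_subset[OF sm] by (auto intro!: subspace_sum[OF sub])
      then show ?case using insert by (simp add: is_rep_act_add[OF R g])
    qed
    show "P U (act R g x) = act (subrep R U) g (P U x)"
      unfolding subrep_simps
    proof (rule P_eq)
      have "act R g x = act R g (\<Sum>U\<in>D. P U x)" using P x by simp
      then show "act R g x = (\<Sum>U\<in>D. act R g (P U x))" by (simp only: act_sum[OF subset_refl])
    qed (use x U PU g is_rep_act_closed[OF R] is_submodule_act[OF sm] in auto)
  qed (use PU U in simp)
  then show thesis using that[of P] P by blast
qed

lemma rep_hom_subrep:
  assumes "rep_hom G R (subrep R' U) f" "U \<subseteq> vecs R'"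
  shows "rep_hom G R R' f"
  using assms by (auto simp: rep_hom_def)

lemma rep_hom_restrict:
  assumes "rep_hom G R L f" "U \<subseteq> vecs R"
  shows "rep_hom G (subrep R U) L f"
  using assms unfolding rep_hom_def subrep_simps by (meson subsetD)

section \<open>The form defined by an involution of a finite group\<close>

lemma sum_fun_apply: "(\<Sum>i\<in>I. f i) g = (\<Sum>i\<in>I. f i g)"
  by (induction I rule: infinite_finite_induct) auto

locale finite_group_involution = group G for G (structure) +
  fixes w0
  assumes finite_carrier: "finite (carrier G)"
    and w0_closed: "w0 \<in> carrier G" and w0_w0: "w0 \<otimes> w0 = \<one>"
begin

section \<open>Standard inner product and right multiplication by \<open>w0\<close>\<close>

abbreviation "GA \<equiv> group_algebra G"
abbreviation "V \<equiv> vecs (group_algebra G)"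
abbreviation "\<beta> \<equiv> beta_infinity G w0"

definition ip :: "('a \<Rightarrow> complex) \<Rightarrow> ('a \<Rightarrow> complex) \<Rightarrow> complex" where
  "ip x y = (\<Sum>g\<in>carrier G. x g * cnj (y g))"

text \<open>Right multiplication by the basis element of \<open>w0\<close>: the coefficient at
  \<open>g\<close> of the product is \<open>x (g \<otimes> inv w0)\<close>, and \<open>w0\<close> is
  its own inverse.\<close>

definition rmul :: "('a \<Rightarrow> complex) \<Rightarrow> 'a \<Rightarrow> complex" where
  "rmul x = (\<lambda>g. if g \<in> carrier G then x (g \<otimes> w0) else 0)"

lemma scal_GA: "scal GA c x = (\<lambda>g. c * x g)"
  and vecs_GA: "V = {x. \<forall>g. g \<notin> carrier G \<longrightarrow> x g = 0}"
  by (simp_all add: group_algebra_def)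

text \<open>Convolution with a basis element has a single nonzero term, so the action is left
  translation of functions.\<close>

lemma act_GA:
  assumes "w \<in> carrier G"
  shows "act GA w x = (\<lambda>g. if g \<in> carrier G then x (inv w \<otimes> g) else 0)"
proof -
  have "(\<Sum>h\<in>carrier G. t_basis w h * x (inv h \<otimes> g))
      = (\<Sum>h\<in>carrier G. if h = w then x (inv h \<otimes> g) else 0)" for g
    by (rule sum.cong) (auto simp: t_basis_def)
  then show ?thesis
    using assms finite_carrier by (auto simp: group_algebra_def ga_mult_def)
qed

lemma ga_mult_t_basis:
  assumes "a \<in> carrier G" "b \<in> carrier G"
  shows "ga_mult G (t_basis a) (t_basis b) = t_basis (a \<otimes> b)"
proof
  fix g
  have "inv a \<otimes> g = b \<longleftrightarrow> g = a \<otimes> b" if "g \<in> carrier G"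
    using inv_solve_left[of b a g] assms that by auto
  then show "ga_mult G (t_basis a) (t_basis b) g = t_basis (a \<otimes> b) g"
    using act_GA[OF assms(1), of "t_basis b"] assms
    by (auto simp: group_algebra_def t_basis_def)
qed

lemma ip_sym: "ip y x = cnj (ip x y)"
  by (simp add: ip_def mult.commute)

lemma ip_add_left: "ip (x + y) z = ip x z + ip y z"
  by (simp add: ip_def algebra_simps sum.distrib)

lemma ip_diff_left: "ip (x - y) z = ip x z - ip y z"
  by (simp add: ip_def algebra_simps sum_subtractf)

lemma ip_scal_left: "ip (scal GA c x) y = c * ip x y"
  by (simp add: ip_def scal_GA sum_distrib_left mult.assoc)

lemma ip_scal_right: "ip x (scal GA c y) = cnj c * ip x y"
  using ip_scal_left[of c y x] ip_sym[of x "scal GA c y"] ip_sym[of x y] by simp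

lemma ip_sum_left: "ip (\<Sum>i\<in>I. f i) y = (\<Sum>i\<in>I. ip (f i) y)"
  unfolding ip_def sum_fun_apply sum_distrib_right by (rule sum.swap)

lemma ip_sum_right: "ip x (\<Sum>i\<in>I. f i) = (\<Sum>i\<in>I. ip x (f i))"
  unfolding ip_def sum_fun_apply cnj_sum sum_distrib_left by (rule sum.swap)

lemma ip_zero_left [simp]: "ip 0 y = 0"
  by (simp add: ip_def)

lemma ip_zero_right [simp]: "ip x 0 = 0"
  by (simp add: ip_def)

lemma ip_pos:
  assumes "x \<in> V" "x \<noteq> 0"
  shows "0 < Re (ip x x)"
proof -
  have "Re (ip x x) = (\<Sum>g\<in>carrier G. (cmod (x g))\<^sup>2)"
    by (simp add: ip_def complex_mult_cnj cmod_power2)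
  moreover obtain g where "x g \<noteq> 0" using assms(2) by (auto simp: fun_eq_iff)
  then have "g \<in> carrier G" using assms(1) by (auto simp: vecs_GA)
  then have "0 < (\<Sum>g\<in>carrier G. (cmod (x g))\<^sup>2)"
    using \<open>x g \<noteq> 0\<close> finite_carrier by (intro sum_pos2[of _ g]) auto
  ultimately show ?thesis by simp
qed

lemma ip_eq_0: "x \<in> V \<Longrightarrow> ip x x = 0 \<Longrightarrow> x = 0"
  using ip_pos by fastforce

lemma ip_act:
  assumes "w \<in> carrier G"
  shows "ip (act GA w x) (act GA w y) = ip x y"
  unfolding ip_def act_GA[OF assms]
  by (rule sum.reindex_bij_witness[of _ "\<lambda>g. w \<otimes> g" "\<lambda>g. inv w \<otimes> g"])
    (use assms in \<open>auto simp: m_assoc[symmetric]\<close>)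

lemma w0_cancel: "g \<in> carrier G \<Longrightarrow> g \<otimes> w0 \<otimes> w0 = g"
  by (simp add: m_assoc w0_closed w0_w0)

text \<open>The substitution of \<open>g \<otimes> w0\<close> for \<open>g\<close> is its own
  inverse, which makes \<open>rmul\<close> self-adjoint.\<close>

lemma ip_rmul: "ip (rmul x) y = ip x (rmul y)"
  unfolding ip_def rmul_def
  by (rule sum.reindex_bij_witness[of _ "\<lambda>g. g \<otimes> w0" "\<lambda>g. g \<otimes> w0"])
    (auto simp: w0_cancel w0_closed)

lemma rmul_rmul: "x \<in> V \<Longrightarrow> rmul (rmul x) = x"
  by (auto simp: rmul_def w0_cancel w0_closed vecs_GA fun_eq_iff)

lemma rep_hom_rmul: "rep_hom G GA GA rmul"
proof (rule rep_homI)
  fix g x assume "g \<in> carrier G"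
  then show "rmul (act GA g x) = act GA g (rmul x)"
    by (auto simp: act_GA rmul_def w0_closed m_assoc)
qed (auto simp: rmul_def vecs_GA scal_GA fun_eq_iff)

text \<open>\<open>ga_eps\<close> of the triple product of basis elements is 1 exactly when
  \<open>w' = w \<otimes> w0\<close>, so the double sum collapses to \<open>ip x (rmul y)\<close>;
  self-adjointness moves \<open>rmul\<close> to the left.\<close>

lemma beta_eq_ip: "\<beta> x y = ip (rmul x) y"
proof -
  have "ga_eps G (ga_mult G (ga_mult G (t_basis (inv w')) (t_basis w)) (t_basis w0))
      = (if w' = w \<otimes> w0 then 1 else 0)" if "w \<in> carrier G" "w' \<in> carrier G" for w w'
  proof -
    have "\<one> = inv w' \<otimes> w \<otimes> w0 \<longleftrightarrow> w' = w \<otimes> w0"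
      using inv_solve_left[of \<one> w' "w \<otimes> w0"] that w0_closed by (auto simp: m_assoc)
    moreover have "ga_mult G (ga_mult G (t_basis (inv w')) (t_basis w)) (t_basis w0)
        = t_basis (inv w' \<otimes> w \<otimes> w0)"
      using that w0_closed by (simp add: ga_mult_t_basis)
    ultimately show ?thesis by (simp add: ga_eps_def t_basis_def)
  qed
  then have "\<beta> x y = (\<Sum>w\<in>carrier G. \<Sum>w'\<in>carrier G.
      if w' = w \<otimes> w0 then x w * cnj (y w') else 0)"
    unfolding beta_infinity_def by (intro sum.cong) auto
  also have "\<dots> = ip x (rmul y)"
    unfolding ip_def rmul_def using w0_closed finite_carrier by (intro sum.cong) auto
  finally show ?thesis by (simp add: ip_rmul)
qed

lemma is_rep_GA: "is_rep G GA"
proof -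
  interpret GV: vector_space "scal GA"
    by unfold_locales (auto simp: scal_GA algebra_simps fun_eq_iff)
  have span: "V = GV.span (t_basis ` carrier G)"
  proof
    show "V \<subseteq> GV.span (t_basis ` carrier G)"
    proof
      fix x assume x: "x \<in> V"
      have "x = (\<Sum>h\<in>carrier G. scal GA (x h) (t_basis h))"
      proof
        fix g
        have "(\<Sum>h\<in>carrier G. x h * t_basis h g) = (\<Sum>h\<in>carrier G. if h = g then x h else 0)"
          by (rule sum.cong) (auto simp: t_basis_def)
        then show "x g = (\<Sum>h\<in>carrier G. scal GA (x h) (t_basis h)) g"
          using x finite_carrier by (auto simp: sum_fun_apply scal_GA vecs_GA)
      qed
      also have "\<dots> \<in> GV.span (t_basis ` carrier G)"
        by (intro GV.span_sum GV.span_scale GV.span_base) auto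
      finally show "x \<in> GV.span (t_basis ` carrier G)" .
    qed
    show "GV.span (t_basis ` carrier G) \<subseteq> V"
      by (rule GV.span_minimal) (auto simp: GV.subspace_def vecs_GA scal_GA t_basis_def)
  qed
  have mult: "act GA (g \<otimes> h) x = act GA g (act GA h x)" if "g \<in> carrier G" "h \<in> carrier G" for g h x
    using that by (auto simp: act_GA fun_eq_iff inv_mult_group m_assoc)
  show ?thesis
    unfolding is_rep_def
    using span GV.vector_space_axioms is_group finite_carrier mult
    by (auto simp: act_GA fun_eq_iff scal_GA vecs_GA intro!: exI[of _ "t_basis ` carrier G"])
qed

lemma hermitian_beta: "hermitian_form_on GA \<beta>"
  unfolding hermitian_form_on_def beta_eq_ip
  by (auto simp: rep_hom_add[OF rep_hom_rmul] rep_hom_scal[OF rep_hom_rmul] ip_add_left ip_scal_left)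
    (metis ip_rmul ip_sym)

lemma invariant_beta: "invariant_form_on G GA \<beta>"
  by (simp add: invariant_form_on_def beta_eq_ip rep_hom_act[OF rep_hom_rmul] ip_act)

text \<open>Pairing \<open>x\<close> with \<open>rmul x\<close> yields
  \<open>ip (rmul x) (rmul x) = ip x x\<close>, which is positive unless
  \<open>x = 0\<close>.\<close>

lemma nondegenerate_beta: "nondegenerate_on GA \<beta>"
  unfolding nondegenerate_on_def
proof (intro ballI impI)
  fix x assume x: "x \<in> V" and "\<forall>y\<in>V. \<beta> x y = 0"
  then have "ip (rmul x) (rmul x) = 0"
    using rep_hom_closed[OF rep_hom_rmul x] by (simp add: beta_eq_ip)
  then show "x = 0" using x by (simp add: ip_rmul rmul_rmul ip_eq_0)
qed

section \<open>Existence of an orthogonal decomposition\<close>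

lemma vector_space_GA: "vector_space (scal GA)"
  by (rule is_rep_vector_space[OF is_rep_GA])

text \<open>Gram-Schmidt: each new generator \<open>b\<close> is replaced by its difference
  \<open>b - v\<close> from its projection to the span of the earlier ones, and \<open>x\<close> is
  corrected by a multiple of that difference.\<close>

lemma orthogonal_projection:
  assumes U: "is_submodule G GA U" and x: "x \<in> V"
  shows "\<exists>u\<in>U. \<forall>y\<in>U. ip (x - u) y = 0"
proof -
  interpret GV: vector_space "scal GA" by (rule vector_space_GA)
  note subV = is_rep_subspace[OF is_rep_GA]
  have *: "\<exists>u\<in>GV.span B. \<forall>y\<in>GV.span B. ip (x - u) y = 0"
    if "finite B" "B \<subseteq> V" "x \<in> V" for B x
    using that
  proof (induction B arbitrary: x rule: finite_induct)
    case empty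
    then show ?case by (auto simp: ip_def)
  next
    case (insert b B)
    obtain u where u: "u \<in> GV.span B" "\<And>y. y \<in> GV.span B \<Longrightarrow> ip (x - u) y = 0"
      using insert by blast
    obtain v where v: "v \<in> GV.span B" "\<And>y. y \<in> GV.span B \<Longrightarrow> ip (b - v) y = 0"
      using insert.IH[of b] insert.prems by blast
    let ?b = "b - v"
    \<comment> \<open>If \<open>b\<close> already lies in the span of \<open>B\<close>, then
      \<open>?b\<close> is zero and no correction is made; the default 0 avoids the division by
      zero.\<close>
    define c where "c = (if ip ?b ?b = 0 then 0 else ip (x - u) ?b / ip ?b ?b)"
    have BV: "GV.span B \<subseteq> V" using insert.prems subV by (intro GV.span_minimal) auto
    have "?b \<in> V" using insert.prems v(1) BV by (auto intro!: GV.subspace_diff[OF subV])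
    then have c: "ip (x - u) ?b = c * ip ?b ?b"
      using ip_eq_0[of ?b] by (auto simp: c_def)
    have sub: "GV.span B \<subseteq> GV.span (insert b B)" by (rule GV.span_mono) auto
    show ?case
    proof (intro bexI ballI)
      show "u + scal GA c ?b \<in> GV.span (insert b B)"
        using u(1) v(1) sub GV.span_base[of b "insert b B"]
        by (intro GV.span_add GV.span_scale GV.span_diff) auto
      fix y assume "y \<in> GV.span (insert b B)"
      then obtain k where k: "y - scal GA k b \<in> GV.span B"
        by (auto simp: GV.span_breakdown_eq)
      \<comment> \<open>\<open>z\<close> is the part of \<open>y\<close> inside the span of
        \<open>B\<close>; what remains is \<open>k\<close> times the new direction
        \<open>?b\<close>.\<close>
      define z where "z = y - scal GA k b + scal GA k v"
      have z: "z \<in> GV.span B" using k v(1) by (simp add: z_def GV.span_add GV.span_scale)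
      have y: "y = z + scal GA k ?b" by (simp add: z_def GV.scale_right_diff_distrib)
      have ip_right: "ip a y = ip a z + cnj k * ip a ?b" for a
      proof -
        have "ip y a = ip z a + k * ip ?b a" unfolding y by (simp only: ip_add_left ip_scal_left)
        then show ?thesis by (simp add: ip_sym[of a y] ip_sym[of a z] ip_sym[of a ?b])
      qed
      have "ip (x - (u + scal GA c ?b)) w = ip (x - u) w - c * ip ?b w" for w
        using ip_diff_left[of "x - u" "scal GA c ?b" w] ip_scal_left[of c ?b w]
        by (simp add: diff_diff_eq)
      then show "ip (x - (u + scal GA c ?b)) y = 0"
        using u(2)[OF z] v(2)[OF z] c by (simp add: ip_right)
    qed
  qed
  obtain B where B: "finite B" "V = GV.span B" using is_rep_finite_span[OF is_rep_GA] by blast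
  obtain C where "finite C" "GV.span C = U" "C \<subseteq> U"
    using GV.subspace_finite_basis[OF is_submodule_subspace[OF U], of B] B is_submodule_subset[OF U]
    by metis
  then show ?thesis using *[of C x] x is_submodule_subset[OF U] by blast
qed

text \<open>Pairing the vanishing sum with \<open>v U\<close> leaves only
  \<open>ip (v U) (v U)\<close>.\<close>

lemma orthogonal_sum_unique:
  assumes "finite D" and sub: "\<And>U. U \<in> D \<Longrightarrow> is_submodule G GA U"
    and orth: "\<And>U U' x y. U \<in> D \<Longrightarrow> U' \<in> D \<Longrightarrow> U \<noteq> U' \<Longrightarrow> x \<in> U \<Longrightarrow> y \<in> U' \<Longrightarrow> ip x y = 0"
    and v: "\<And>U. U \<in> D \<Longrightarrow> v U \<in> U" and "(\<Sum>U\<in>D. v U) = 0" and U: "U \<in> D"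
  shows "v U = 0"
proof -
  have "ip (\<Sum>U\<in>D. v U) (v U) = (\<Sum>U'\<in>D. if U' = U then ip (v U) (v U) else 0)"
    unfolding ip_sum_left using orth[OF _ U _ v v[OF U]] by (intro sum.cong) auto
  then have "ip (\<Sum>U\<in>D. v U) (v U) = ip (v U) (v U)"
    using \<open>finite D\<close> U by simp
  then show ?thesis
    using assms(5) ip_eq_0[of "v U"] v[OF U] is_submodule_subset[OF sub[OF U]] by auto
qed

text \<open>Partial decompositions whose members also lie in eigenspaces of \<open>rmul\<close>. On
  such members \<beta> agrees with \<open>ip\<close> up to sign, so orthogonality for the positive
  definite \<open>ip\<close> implies orthogonality for \<beta>.\<close>

definition orth_family :: "('a \<Rightarrow> complex) set set \<Rightarrow> bool" where
  "orth_family D \<longleftrightarrow> finite D \<and>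
     (\<forall>U\<in>D. is_submodule G GA U \<and> irreducible_rep G (subrep GA U) \<and>
        ((\<forall>x\<in>U. rmul x = x) \<or> (\<forall>x\<in>U. rmul x = - x))) \<and>
     (\<forall>U\<in>D. \<forall>U'\<in>D. U \<noteq> U' \<longrightarrow> (\<forall>x\<in>U. \<forall>y\<in>U'. ip x y = 0))"

text \<open>Nonzero vectors chosen from the members are pairwise orthogonal, hence independent in a
  space of dimension \<open>card (carrier G)\<close>. The bound lets a family of greatest
  cardinality be chosen.\<close>

lemma card_orth_family:
  assumes D: "orth_family D"
  shows "card D \<le> card (carrier G)"
proof (rule ccontr)
  assume less: "\<not> card D \<le> card (carrier G)"
  have fin: "finite D" and sm: "\<And>U. U \<in> D \<Longrightarrow> is_submodule G GA U"
    and orth: "\<And>U U' x y. U \<in> D \<Longrightarrow> U' \<in> D \<Longrightarrow> U \<noteq> U' \<Longrightarrow> x \<in> U \<Longrightarrow> y \<in> U' \<Longrightarrow> ip x y = 0"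
    using D by (auto simp: orth_family_def)
  have "\<exists>x\<in>U. x \<noteq> 0" if "U \<in> D" for U
  proof -
    have "irreducible_rep G (subrep GA U)" "is_submodule G GA U"
      using D that by (auto simp: orth_family_def)
    interpret GV: vector_space "scal GA" by (rule vector_space_GA)
    have "0 \<in> U" using \<open>is_submodule G GA U\<close> by (rule GV.subspace_0[OF is_submodule_subspace])
    then show ?thesis using irreducible_nonzero[OF \<open>irreducible_rep G (subrep GA U)\<close>] by auto
  qed
  then obtain x where x: "\<And>U. U \<in> D \<Longrightarrow> x U \<in> U \<and> x U \<noteq> 0" by metis
  obtain a where a: "\<exists>U\<in>D. a U \<noteq> 0" "\<forall>g\<in>carrier G. (\<Sum>U\<in>D. a U * x U g) = 0"
    using homogeneous_system_nontrivial[OF finite_carrier fin, of "\<lambda>U g. x U g"] less by auto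
  interpret GV: vector_space "scal GA" by (rule vector_space_GA)
  have xU: "scal GA (a U) (x U) \<in> U" if "U \<in> D" for U
    using x[OF that] GV.subspace_scale[OF is_submodule_subspace[OF sm[OF that]]] by blast
  then have xV: "scal GA (a U) (x U) \<in> V" if "U \<in> D" for U
    using that is_submodule_subset[OF sm] by blast
  have sum0: "(\<Sum>U\<in>D. scal GA (a U) (x U)) = 0"
  proof
    fix g
    show "(\<Sum>U\<in>D. scal GA (a U) (x U)) g = 0 g"
    proof (cases "g \<in> carrier G")
      case True
      then show ?thesis using a(2) by (simp add: sum_fun_apply scal_GA)
    next
      case False
      then have "scal GA (a U) (x U) g = 0" if "U \<in> D" for U
        using xV[OF that] by (simp add: vecs_GA)
      then show ?thesis by (simp add: sum_fun_apply)
    qed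
  qed
  have "scal GA (a U) (x U) = 0" if "U \<in> D" for U
    by (intro orthogonal_sum_unique[where D = D and U = U and v = "\<lambda>U. scal GA (a U) (x U)"])
      (use fin sm orth xU sum0 that in blast)+
  then show False using a(1) x by auto
qed

text \<open>Invariance of \<open>ip\<close> moves \<open>g\<close> to the other argument as
  \<open>inv g\<close>, where it preserves every member of \<open>D\<close>.\<close>

lemma orth_complement_submodule:
  assumes "\<And>U. U \<in> D \<Longrightarrow> is_submodule G GA U"
  shows "is_submodule G GA {x \<in> V. \<forall>U\<in>D. \<forall>y\<in>U. ip x y = 0}" (is "is_submodule G GA ?W")
  unfolding is_submodule_def is_subspace_def
proof (intro conjI ballI)
  interpret GV: vector_space "scal GA" by (rule vector_space_GA)
  show "GV.subspace ?W"
    using is_rep_subspace[OF is_rep_GA]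
    by (auto simp: GV.subspace_def ip_add_left ip_scal_left)
  fix g x assume g: "g \<in> carrier G" and x: "x \<in> ?W"
  have "ip (act GA g x) y = 0" if "U \<in> D" "y \<in> U" for U y
  proof -
    have yV: "y \<in> V" using that assms is_submodule_subset by blast
    have "ip x (act GA (inv g) y) = 0"
      using x that is_submodule_act[OF assms] g by auto
    moreover have "act GA g (act GA (inv g) y) = y"
      using is_rep_act_mult[OF is_rep_GA g inv_closed[OF g] yV] is_rep_act_one[OF is_rep_GA yV] g
      by simp
    ultimately show ?thesis using ip_act[OF g, of x "act GA (inv g) y"] by simp
  qed
  then show "act GA g x \<in> ?W" using is_rep_act_closed[OF is_rep_GA g] x by auto
qed auto

text \<open>The orthogonal complement \<open>W\<close> of the family is nonzero and stable under
  \<open>G\<close> and \<open>rmul\<close>. An eigenspace of \<open>rmul\<close> on \<open>W\<close>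
  is therefore a submodule, and an irreducible submodule of a nonzero one can be added.\<close>

lemma exists_orth_family_extension:
  assumes D: "orth_family D" and x: "x \<in> V" "x \<noteq> 0" and x_orth: "\<And>U y. U \<in> D \<Longrightarrow> y \<in> U \<Longrightarrow> ip x y = 0"
  shows "\<exists>A. A \<notin> D \<and> orth_family (insert A D)"
proof -
  interpret GV: vector_space "scal GA" by (rule vector_space_GA)
  define W where "W = {x \<in> V. \<forall>U\<in>D. \<forall>y\<in>U. ip x y = 0}"
  have smD: "\<And>U. U \<in> D \<Longrightarrow> is_submodule G GA U" using D by (auto simp: orth_family_def)
  then have W: "is_submodule G GA W" unfolding W_def by (rule orth_complement_submodule)
  \<comment> \<open>\<open>rmul\<close> is self-adjoint and acts on each member of \<open>D\<close>
    by a sign, so it preserves orthogonality to \<open>D\<close>.\<close>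
  have rmulW: "rmul z \<in> W" if "z \<in> W" for z
  proof -
    have "ip (rmul z) y = 0" if "U \<in> D" "y \<in> U" for U y
    proof -
      have "ip z y = 0" using \<open>z \<in> W\<close> that by (auto simp: W_def)
      moreover have "ip z (- y) = - ip z y" by (simp add: ip_def sum_negf)
      moreover have "rmul y = y \<or> rmul y = - y" using D that by (auto simp: orth_family_def)
      ultimately show ?thesis by (auto simp: ip_rmul)
    qed
    then show ?thesis using that rep_hom_closed[OF rep_hom_rmul] by (auto simp: W_def)
  qed
  have eig: "is_submodule G GA {z \<in> W. rmul z = scal GA s z}" for s
    unfolding is_submodule_def is_subspace_def
  proof (intro conjI ballI)
    note subW = is_submodule_subspace[OF W]
    have WV: "z \<in> V" if "z \<in> W" for z using that by (simp add: W_def)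
    show "GV.subspace {z \<in> W. rmul z = scal GA s z}"
      using subW rep_hom_zero[OF is_rep_GA is_rep_GA rep_hom_rmul]
      by (auto simp: GV.subspace_def rep_hom_add[OF rep_hom_rmul] rep_hom_scal[OF rep_hom_rmul] WV
          GV.scale_right_distrib GV.scale_left_commute)
    fix g z assume "g \<in> carrier G" "z \<in> {z \<in> W. rmul z = scal GA s z}"
    then show "act GA g z \<in> {z \<in> W. rmul z = scal GA s z}"
      using is_submodule_act[OF W] WV
      by (simp add: rep_hom_act[OF rep_hom_rmul] is_rep_act_scal[OF is_rep_GA])
  qed (simp add: W_def)
  have xW: "x \<in> W" using x x_orth by (auto simp: W_def)
  \<comment> \<open>If \<open>x\<close> is not in the -1-eigenspace, then \<open>x + rmul x\<close>
    is a nonzero vector of the 1-eigenspace.\<close>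
  have "\<exists>s\<in>{1, -1}. {z \<in> W. rmul z = scal GA s z} \<noteq> {0}"
  proof (cases "rmul x = - x")
    case True
    then have "x \<in> {z \<in> W. rmul z = scal GA (-1) z}" using xW by simp
    then show ?thesis using x by blast
  next
    case False
    then have "x + rmul x \<noteq> 0" by (metis add_eq_0_iff)
    moreover have "x + rmul x \<in> {z \<in> W. rmul z = scal GA 1 z}"
      using xW rmulW GV.subspace_add[OF is_submodule_subspace[OF W]] x
      by (simp add: rep_hom_add[OF rep_hom_rmul] rep_hom_closed[OF rep_hom_rmul] rmul_rmul add.commute)
    ultimately show ?thesis by blast
  qed
  then obtain s where s: "s \<in> {1, -1}" "{z \<in> W. rmul z = scal GA s z} \<noteq> {0}" by blast
  obtain A where A: "A \<subseteq> {z \<in> W. rmul z = scal GA s z}" "is_submodule G GA A"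
    "irreducible_rep G (subrep GA A)"
    using exists_irreducible_submodule[OF is_rep_GA eig s(2)] by blast
  have "ip z y = 0" "ip y z = 0" if "z \<in> A" "U \<in> D" "y \<in> U" for z U y
    using A(1) that ip_sym[of y z] by (auto simp: W_def)
  moreover have "(\<forall>x\<in>A. rmul x = x) \<or> (\<forall>x\<in>A. rmul x = - x)"
    using A(1) s(1) by auto
  ultimately have "orth_family (insert A D)"
    using D A(2,3) unfolding orth_family_def by auto
  \<comment> \<open>A member of \<open>D\<close> contained in \<open>W\<close> would be orthogonal
    to itself and hence zero.\<close>
  moreover have "A \<notin> D"
  proof
    assume "A \<in> D"
    then have "z = 0" if "z \<in> A" for z
      using A(1) that ip_eq_0[of z] by (auto simp: W_def)
    then have "A = {0}" using GV.subspace_0[OF is_submodule_subspace[OF A(2)]] by blast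
    then show False using irreducible_nonzero[OF A(3)] by simp
  qed
  ultimately show ?thesis by blast
qed

text \<open>An \<open>orth_family\<close> of greatest cardinality works: the remainder
  \<open>z\<close> of a vector after subtracting its projections is orthogonal to all members, and a
  nonzero \<open>z\<close> would allow an extension.\<close>

lemma exists_orthogonal_decomposition: "\<exists>D. orthogonal_decomposition G GA \<beta> D"
proof -
  interpret GV: vector_space "scal GA" by (rule vector_space_GA)
  have "orth_family {}" by (simp add: orth_family_def)
  then obtain D where D: "orth_family D" and max: "\<And>E. orth_family E \<Longrightarrow> card E \<le> card D"
    using ex_has_greatest_nat[of orth_family "{}" card "Suc (card (carrier G))"] card_orth_family
    by (metis le_imp_less_Suc)
  have fin: "finite D" and sm: "\<And>U. U \<in> D \<Longrightarrow> is_submodule G GA U"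
    and irr: "\<And>U. U \<in> D \<Longrightarrow> irreducible_rep G (subrep GA U)"
    and eig: "\<And>U x. U \<in> D \<Longrightarrow> x \<in> U \<Longrightarrow> rmul x = x \<or> rmul x = - x"
    and orth: "\<And>U U' x y. U \<in> D \<Longrightarrow> U' \<in> D \<Longrightarrow> U \<noteq> U' \<Longrightarrow> x \<in> U \<Longrightarrow> y \<in> U' \<Longrightarrow> ip x y = 0"
    using D by (auto simp: orth_family_def)
  note subU = is_submodule_subspace[OF sm]
  have "\<exists>!u. u \<in> (\<Pi>\<^sub>E U\<in>D. U) \<and> x = (\<Sum>U\<in>D. u U)" if x: "x \<in> V" for x
  proof -
    obtain p where p: "\<And>U. U \<in> D \<Longrightarrow> p U \<in> U \<and> (\<forall>y\<in>U. ip (x - p U) y = 0)"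
      using orthogonal_projection[OF sm x] by metis
    define z where "z = x - (\<Sum>U\<in>D. p U)"
    have pV: "p U \<in> V" if "U \<in> D" for U
      using p[OF that] is_submodule_subset[OF sm[OF that]] by blast
    have "ip z y = 0" if U: "U \<in> D" "y \<in> U" for U y
    proof -
      have "(\<Sum>U'\<in>D. ip (p U') y) = (\<Sum>U'\<in>D. if U' = U then ip (p U) y else 0)"
        using orth U p by (intro sum.cong) auto
      then have "ip z y = ip (x - p U) y"
        using fin U by (simp add: z_def ip_diff_left ip_sum_left)
      then show ?thesis using p U by simp
    qed
    moreover have "z \<in> V"
      unfolding z_def using x pV is_rep_subspace[OF is_rep_GA]
      by (intro GV.subspace_diff GV.subspace_sum) auto
    ultimately have "z = 0"
      using exists_orth_family_extension[OF D, of z] max fin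
      by (metis card_insert_disjoint not_less_eq_eq order_refl)
    then have eq: "x = (\<Sum>U\<in>D. p U)" by (simp add: z_def)
    show ?thesis
    proof (rule ex1I[of _ "restrict p D"])
      show "restrict p D \<in> (\<Pi>\<^sub>E U\<in>D. U) \<and> x = (\<Sum>U\<in>D. restrict p D U)"
        using p eq by auto
      fix u assume u: "u \<in> (\<Pi>\<^sub>E U\<in>D. U) \<and> x = (\<Sum>U\<in>D. u U)"
      have "u U - p U = 0" if "U \<in> D" for U
      proof (rule orthogonal_sum_unique[where D = D and v = "\<lambda>U. u U - p U"])
        show "u U - p U \<in> U" if "U \<in> D" for U
          using u p that subU[OF that] by (intro GV.subspace_diff) auto
        show "(\<Sum>U\<in>D. u U - p U) = 0" using u eq by (simp add: sum_subtractf)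
      qed (use fin sm orth that in auto)
      then show "u = restrict p D"
        using u by (intro ext) (auto simp: PiE_def extensional_def)
    qed
  qed
  moreover have "\<beta> x y = 0" if "U \<in> D" "U' \<in> D" "U \<noteq> U'" "x \<in> U" "y \<in> U'" for U U' x y
  proof -
    have "ip (- x) y = - ip x y" by (simp add: ip_def sum_negf)
    then show ?thesis using eig[OF that(1,4)] orth[OF that] by (auto simp: beta_eq_ip)
  qed
  ultimately have "orthogonal_decomposition G GA \<beta> D"
    using fin sm irr by (auto simp: orthogonal_decomposition_def)
  then show ?thesis by blast
qed

section \<open>Definiteness of the summands\<close>

lemma beta_sum_left: "finite I \<Longrightarrow> (\<And>i. i \<in> I \<Longrightarrow> f i \<in> V) \<Longrightarrow> \<beta> (\<Sum>i\<in>I. f i) y = (\<Sum>i\<in>I. \<beta> (f i) y)"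
  using rep_hom_sum[OF is_rep_GA is_rep_GA rep_hom_rmul, of I f "\<lambda>_. 1"]
  by (simp add: beta_eq_ip ip_sum_left scal_GA)

lemma orthogonal_decompositionD:
  assumes "orthogonal_decomposition G GA \<beta> D"
  shows "finite D" "U \<in> D \<Longrightarrow> is_submodule G GA U" "U \<in> D \<Longrightarrow> irreducible_rep G (subrep GA U)"
    "U \<in> D \<Longrightarrow> U \<subseteq> V"
    "U \<in> D \<Longrightarrow> U' \<in> D \<Longrightarrow> U \<noteq> U' \<Longrightarrow> x \<in> U \<Longrightarrow> y \<in> U' \<Longrightarrow> \<beta> x y = 0"
  using assms by (auto simp: orthogonal_decomposition_def is_submodule_def)

text \<open>An arbitrary decomposition may have summands that \<open>rmul\<close> does not preserve.
  By Schur's lemma \<open>rmul\<close> followed by the projection to \<open>U\<close> is still a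
  scalar \<open>c\<close> on \<open>U\<close>, and \<open>c * \<beta> x x = ip x x\<close> shows
  that the sign of \<open>\<beta> x x\<close> is that of \<open>Re c\<close>.\<close>

lemma decomposition_definite:
  assumes D: "orthogonal_decomposition G GA \<beta> D" and U: "U \<in> D"
  shows "positive_definite_on U \<beta> \<or> negative_definite_on U \<beta>"
proof -
  note D' = orthogonal_decompositionD[OF D]
  interpret GV: vector_space "scal GA" by (rule vector_space_GA)
  obtain P where P: "\<And>U. U \<in> D \<Longrightarrow> rep_hom G GA (subrep GA U) (P U)"
    "\<And>x. x \<in> V \<Longrightarrow> x = (\<Sum>U\<in>D. P U x)"
    using decomposition_projections[OF is_rep_GA D] by blast
  have hom: "rep_hom G (subrep GA U) (subrep GA U) (\<lambda>x. P U (rmul x))"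
    using rep_hom_comp[OF rep_hom_restrict[OF rep_hom_rmul D'(4)[OF U]] P(1)[OF U]] .
  have "\<exists>c. \<forall>x\<in>U. P U (rmul x) = scal GA c x"
    using schur_endomorphism[OF D'(3)[OF U] hom] by simp
  then obtain c where c: "\<And>x. x \<in> U \<Longrightarrow> P U (rmul x) = scal GA c x"
    by blast
  \<comment> \<open>As \<open>rmul\<close> is an involution,
    \<open>ip x x = \<beta> (rmul x) x\<close>; only the component of \<open>rmul x\<close> in
    \<open>U\<close> contributes, the other summands being orthogonal to \<open>x\<close> for
    \<beta>.\<close>
  have key: "c * \<beta> x x = ip x x" if x: "x \<in> U" for x
  proof -
    have xV: "x \<in> V" using x D'(4)[OF U] by blast
    then have rxV: "rmul x \<in> V" by (rule rep_hom_closed[OF rep_hom_rmul])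
    have PU: "P U' (rmul x) \<in> U'" if "U' \<in> D" for U'
      using rep_hom_closed[OF P(1)[OF that] rxV] by simp
    have "ip x x = \<beta> (rmul x) x" by (simp add: beta_eq_ip rmul_rmul[OF xV])
    also have "\<dots> = \<beta> (\<Sum>U'\<in>D. P U' (rmul x)) x" using P(2)[OF rxV] by simp
    also have "\<dots> = (\<Sum>U'\<in>D. \<beta> (P U' (rmul x)) x)"
      using D'(1,4) PU by (intro beta_sum_left) auto
    also have "\<dots> = (\<Sum>U'\<in>D. if U' = U then \<beta> (P U (rmul x)) x else 0)"
      using D'(5)[OF _ U _ PU x] by (intro sum.cong) auto
    also have "\<dots> = \<beta> (scal GA c x) x" using D'(1) U c[OF x] by simp
    also have "\<dots> = c * \<beta> x x"
      by (simp add: beta_eq_ip rep_hom_scal[OF rep_hom_rmul xV] ip_scal_left)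
    finally show ?thesis by simp
  qed
  have real: "\<beta> x x = of_real (Re (\<beta> x x))" for x
  proof -
    have "cnj (\<beta> x x) = \<beta> x x" by (metis beta_eq_ip ip_rmul ip_sym)
    then show ?thesis by (auto simp: complex_eq_iff)
  qed
  have key': "Re c * Re (\<beta> x x) = Re (ip x x)" if "x \<in> U" for x
    unfolding key[OF that, symmetric] by (subst (2) real) simp
  have pos: "0 < Re c * Re (\<beta> x x)" if "x \<in> U" "x \<noteq> 0" for x
    using key'[OF that(1)] ip_pos[of x] that D'(4)[OF U] by auto
  show ?thesis
  proof (cases "0 < Re c")
    case True
    then have "positive_definite_on U \<beta>"
      unfolding positive_definite_on_def using pos zero_less_mult_pos by blast
    then show ?thesis ..
  next
    case False
    then have "negative_definite_on U \<beta>"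
      unfolding negative_definite_on_def using pos by (metis zero_less_mult_iff)
    then show ?thesis ..
  qed
qed

section \<open>Homomorphisms into the group algebra and multiplicities of summands\<close>

lemma rep_hom_GA_sum:
  fixes L :: "('a, 'v::ab_group_add) cplx_rep"
  assumes f: "\<And>U. U \<in> E \<Longrightarrow> rep_hom G L GA (f U)"
  shows "rep_hom G L GA (\<lambda>v. \<Sum>U\<in>E. scal GA (a U) (f U v))"
proof -
  interpret GV: vector_space "scal GA" by (rule vector_space_GA)
  show ?thesis
  proof (rule rep_homI)
    fix v assume "v \<in> vecs L"
    then show "(\<Sum>U\<in>E. scal GA (a U) (f U v)) \<in> V"
      using rep_hom_closed[OF f] is_rep_subspace[OF is_rep_GA]
      by (intro GV.subspace_sum GV.subspace_scale) auto
  next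
    fix v w assume "v \<in> vecs L" "w \<in> vecs L"
    then have "(\<Sum>U\<in>E. scal GA (a U) (f U (v + w)))
        = (\<Sum>U\<in>E. scal GA (a U) (f U v) + scal GA (a U) (f U w))"
      by (intro sum.cong) (simp_all add: rep_hom_add[OF f] GV.scale_right_distrib)
    then show "(\<Sum>U\<in>E. scal GA (a U) (f U (v + w)))
        = (\<Sum>U\<in>E. scal GA (a U) (f U v)) + (\<Sum>U\<in>E. scal GA (a U) (f U w))"
      by (simp only: sum.distrib)
  next
    fix c v assume "v \<in> vecs L"
    then have "(\<Sum>U\<in>E. scal GA (a U) (f U (scal L c v)))
        = (\<Sum>U\<in>E. scal GA c (scal GA (a U) (f U v)))"
      by (intro sum.cong) (simp_all add: rep_hom_scal[OF f] mult.commute)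
    then show "(\<Sum>U\<in>E. scal GA (a U) (f U (scal L c v)))
        = scal GA c (\<Sum>U\<in>E. scal GA (a U) (f U v))"
      by (simp only: GV.scale_sum_right)
  next
    fix g v assume g: "g \<in> carrier G" and v: "v \<in> vecs L"
    have "f U (act L g v) = act GA g (f U v)" if "U \<in> E" for U
      by (rule rep_hom_act[OF f[OF that] g v])
    then have "(\<Sum>U\<in>E. scal GA (a U) (f U (act L g v)))
        = (\<Sum>U\<in>E. scal GA (a U) (act GA g (f U v)))"
      by (intro sum.cong) simp_all
    also have "\<dots> = act GA g (\<Sum>U\<in>E. scal GA (a U) (f U v))"
      by (rule ext) (simp add: act_GA[OF g] sum_fun_apply scal_GA)
    finally show "(\<Sum>U\<in>E. scal GA (a U) (f U (act L g v)))
        = act GA g (\<Sum>U\<in>E. scal GA (a U) (f U v))" .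
  qed
qed

text \<open>
  Evaluation at the unit identifies the homomorphisms from \<open>L\<close> into the group algebra with the linear
  forms on \<open>L\<close>; under this identification right multiplication by \<open>w0\<close> becomes the transpose of the
  action of \<open>w0\<close> on \<open>L\<close>.
\<close>

lemma rep_hom_GA_apply:
  assumes F: "rep_hom G L GA F" and g: "g \<in> carrier G" and v: "v \<in> vecs L"
  shows "F v g = F (act L (inv g) v) \<one>"
  using rep_hom_act[OF F inv_closed[OF g] v] act_GA[OF inv_closed[OF g]] g by simp

lemma rmul_rep_hom_eigen:
  fixes L :: "('a, 'v::ab_group_add) cplx_rep"
  assumes L: "is_rep G L" and F: "rep_hom G L GA F"
    and B: "Modules.module.span (scal L) B = vecs L"
    and eig: "\<And>b. b \<in> B \<Longrightarrow> F (act L w0 b) \<one> = s * F b \<one>"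
    and v: "v \<in> vecs L"
  shows "rmul (F v) = scal GA s (F v)"
proof -
  interpret LV: vector_space "scal L" by (rule is_rep_vector_space[OF L])
  have act0: "act L w0 0 = 0"
    using is_rep_act_scal[OF L w0_closed LV.subspace_0[OF is_rep_subspace[OF L]], of 0] by simp
  \<comment> \<open>The eigenvalue equation is linear in \<open>u\<close>, so it passes from the
    spanning set \<open>B\<close> to all of \<open>vecs L\<close>.\<close>
  have "LV.subspace {u \<in> vecs L. F (act L w0 u) \<one> = s * F u \<one>}"
    using is_rep_subspace[OF L] rep_hom_zero[OF L is_rep_GA F]
    by (auto simp: LV.subspace_def act0 is_rep_act_add[OF L w0_closed] is_rep_act_scal[OF L w0_closed]
        is_rep_act_closed[OF L w0_closed] rep_hom_add[OF F] rep_hom_scal[OF F] algebra_simps scal_GA)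
  moreover have "B \<subseteq> {u \<in> vecs L. F (act L w0 u) \<one> = s * F u \<one>}"
    using eig B LV.span_superset[of B] by auto
  ultimately have all: "F (act L w0 u) \<one> = s * F u \<one>" if "u \<in> vecs L" for u
    using LV.span_minimal[of B] B that by blast
  \<comment> \<open>This turns right multiplication by \<open>w0\<close> in the argument of
    \<open>F v\<close> into the action of \<open>w0\<close> on \<open>L\<close>.\<close>
  have inv: "inv (g \<otimes> w0) = w0 \<otimes> inv g" if "g \<in> carrier G" for g
    using that w0_closed inv_unique'[OF w0_closed w0_closed w0_w0 w0_w0]
    by (simp add: inv_mult_group)
  show ?thesis
  proof
    fix g
    show "rmul (F v) g = scal GA s (F v) g"
    proof (cases "g \<in> carrier G")
      case True
      have "F v (g \<otimes> w0) = F (act L w0 (act L (inv g) v)) \<one>"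
        using rep_hom_GA_apply[OF F _ v, of "g \<otimes> w0"] True w0_closed inv[OF True]
          is_rep_act_mult[OF L w0_closed inv_closed[OF True] v] by simp
      also have "\<dots> = s * F v g"
        using all is_rep_act_closed[OF L inv_closed[OF True] v] rep_hom_GA_apply[OF F True v] by simp
      finally show ?thesis using True by (simp add: rmul_def scal_GA)
    next
      case False
      then show ?thesis using rep_hom_closed[OF F v] by (simp add: rmul_def scal_GA vecs_GA)
    qed
  qed
qed

text \<open>With more summands than elements of \<open>C\<close>, some nontrivial combination
  \<open>F\<close> of embeddings has a linear form vanishing on the \<open>s\<close>-eigenspace of
  \<open>w0\<close>. Then \<open>rmul\<close> is \<open>-s\<close> on the image of \<open>F\<close>,
  so \<open>s * Re (\<beta> (F v) (F v))\<close> is at most zero, while orthogonality of the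
  summands makes it positive. The parameter \<open>s\<close> treats both signs at once.\<close>

lemma card_sign_summands_le:
  fixes L :: "('a, 'v::ab_group_add) cplx_rep" and s :: real
  assumes D: "orthogonal_decomposition G GA \<beta> D" and L: "irreducible_rep G L"
    and B: "finite B" "Modules.module.span (scal L) B = vecs L" "C \<subseteq> B"
    and s: "\<bar>s\<bar> = 1"
    and eigC: "\<And>b. b \<in> C \<Longrightarrow> act L w0 b = scal L (of_real s) b"
    and eigB: "\<And>b. b \<in> B - C \<Longrightarrow> act L w0 b = scal L (of_real (- s)) b"
    and E: "E \<subseteq> D" "\<And>U. U \<in> E \<Longrightarrow> rep_iso G (subrep GA U) L"
    and sign: "\<And>U x. U \<in> E \<Longrightarrow> x \<in> U \<Longrightarrow> x \<noteq> 0 \<Longrightarrow> 0 < s * Re (\<beta> x x)"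
  shows "card E \<le> card C"
proof (rule ccontr)
  assume less: "\<not> card E \<le> card C"
  note D' = orthogonal_decompositionD[OF D]
  note Lrep = irreducible_is_rep[OF L]
  interpret LV: vector_space "scal L" by (rule is_rep_vector_space[OF Lrep])
  have fin: "finite E" using E(1) D'(1) by (rule finite_subset)
  have "\<forall>U\<in>E. \<exists>f. rep_hom G L (subrep GA U) f \<and> bij_betw f (vecs L) U"
    using rep_iso_sym[OF is_rep_subrep[OF is_rep_GA D'(2)] E(2)] E(1)
    by (auto simp: rep_iso_iff_rep_hom)
  then obtain f where f: "\<And>U. U \<in> E \<Longrightarrow> rep_hom G L (subrep GA U) (f U)"
    "\<And>U. U \<in> E \<Longrightarrow> bij_betw (f U) (vecs L) U" by metis
  have fGA: "rep_hom G L GA (f U)" if "U \<in> E" for U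
    using rep_hom_subrep[OF f(1)[OF that]] D'(4) E(1) that by auto
  \<comment> \<open>One unknown for each summand in \<open>E\<close> and one equation for each
    vector of \<open>C\<close>, imposed on the values at the unit.\<close>
  obtain a where a: "\<exists>U\<in>E. a U \<noteq> 0" "\<forall>b\<in>C. (\<Sum>U\<in>E. a U * f U b \<one>) = 0"
    using homogeneous_system_nontrivial[of C E "\<lambda>U b. f U b \<one>"] less fin
      finite_subset[OF B(3,1)] by auto
  define F where "F v = (\<Sum>U\<in>E. scal GA (a U) (f U v))" for v
  have F: "rep_hom G L GA F" unfolding F_def by (rule rep_hom_GA_sum) (rule fGA)
  obtain v where v: "v \<in> vecs L" "v \<noteq> 0"
    using irreducible_nonzero[OF L] LV.subspace_0[OF is_rep_subspace[OF Lrep]] by blast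
  have FvV: "F v \<in> V" by (rule rep_hom_closed[OF F v(1)])
  have rmul_Fv: "rmul (F v) = scal GA (of_real (- s)) (F v)"
  proof (rule rmul_rep_hom_eigen[OF Lrep F B(2) _ v(1)])
    fix b assume b: "b \<in> B"
    then have bL: "b \<in> vecs L" using B(2) LV.span_superset[of B] by auto
    show "F (act L w0 b) \<one> = of_real (- s) * F b \<one>"
    proof (cases "b \<in> C")
      case True
      then have "F b \<one> = 0" using a(2) by (simp add: F_def sum_fun_apply scal_GA)
      then show ?thesis by (simp add: eigC[OF True] rep_hom_scal[OF F bL] scal_GA)
    next
      case False
      then have "act L w0 b = scal L (of_real (- s)) b" using eigB b by blast
      then show ?thesis by (simp only: rep_hom_scal[OF F bL] scal_GA)
    qed
  qed
  have "\<beta> (F v) (F v) = of_real (- s) * ip (F v) (F v)"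
    by (simp only: beta_eq_ip rmul_Fv ip_scal_left)
  then have "s * Re (\<beta> (F v) (F v)) = - (s * s) * Re (ip (F v) (F v))"
    by simp
  moreover have "0 \<le> Re (ip (F v) (F v))"
    using ip_pos[OF FvV] by (cases "F v = 0") auto
  ultimately have "s * Re (\<beta> (F v) (F v)) \<le> 0"
    by (simp add: mult_nonneg_nonneg)
  \<comment> \<open>The cross terms vanish because distinct summands are orthogonal for
    \<beta>.\<close>
  moreover have "\<beta> (F v) (F v) = (\<Sum>U\<in>E. of_real ((cmod (a U))\<^sup>2) * \<beta> (f U v) (f U v))"
  proof -
    have fv: "f U v \<in> U" if "U \<in> E" for U using rep_hom_closed[OF f(1)[OF that] v(1)] by simp
    have fvV: "f U v \<in> V" if "U \<in> E" for U by (rule rep_hom_closed[OF fGA[OF that] v(1)])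
    have scal_left: "\<beta> (scal GA c (f U v)) y = c * \<beta> (f U v) y" if "U \<in> E" for U c y
      by (simp add: beta_eq_ip rep_hom_scal[OF rep_hom_rmul fvV[OF that]] ip_scal_left)
    have sclV: "scal GA (a U) (f U v) \<in> V" if "U \<in> E" for U
      using fvV[OF that] by (simp add: vecs_GA scal_GA)
    have "\<beta> (f U v) (F v) = cnj (a U) * \<beta> (f U v) (f U v)" if U: "U \<in> E" for U
    proof -
      have "\<beta> (f U v) (F v) = (\<Sum>U'\<in>E. cnj (a U') * \<beta> (f U v) (f U' v))"
        by (simp add: F_def beta_eq_ip ip_sum_right ip_scal_right)
      also have "\<dots> = (\<Sum>U'\<in>E. if U' = U then cnj (a U) * \<beta> (f U v) (f U v) else 0)"
        using D'(5)[of U _ "f U v"] fv U E(1) by (intro sum.cong) auto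
      finally show ?thesis using fin U by simp
    qed
    then have summand: "\<beta> (scal GA (a U) (f U v)) (F v) = of_real ((cmod (a U))\<^sup>2) * \<beta> (f U v) (f U v)"
      if "U \<in> E" for U
      using that scal_left by (simp only: complex_norm_square mult.assoc)
    have "\<beta> (F v) y = (\<Sum>U\<in>E. \<beta> (scal GA (a U) (f U v)) y)" for y
      unfolding F_def by (rule beta_sum_left[OF fin sclV])
    then show ?thesis using summand by simp
  qed
  then have "s * Re (\<beta> (F v) (F v)) = (\<Sum>U\<in>E. (cmod (a U))\<^sup>2 * (s * Re (\<beta> (f U v) (f U v))))"
    by (simp add: sum_distrib_left mult.left_commute)
  moreover have "0 < (\<Sum>U\<in>E. (cmod (a U))\<^sup>2 * (s * Re (\<beta> (f U v) (f U v))))"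
  proof -
    have pos: "0 < s * Re (\<beta> (f U v) (f U v))" if U: "U \<in> E" for U
    proof (rule sign[OF U])
      show "f U v \<in> U" using rep_hom_closed[OF f(1)[OF U] v(1)] by simp
      have "f U v \<noteq> f U 0"
        using f(2)[OF U] v LV.subspace_0[OF is_rep_subspace[OF Lrep]]
        by (auto simp: bij_betw_def dest: inj_onD)
      then show "f U v \<noteq> 0" using rep_hom_zero[OF Lrep is_rep_GA fGA[OF U]] by simp
    qed
    obtain U where "U \<in> E" "a U \<noteq> 0" using a(1) by blast
    then show ?thesis
      using fin pos by (intro sum_pos2[of _ U]) (auto intro!: mult_nonneg_nonneg simp: less_imp_le)
  qed
  ultimately show False by simp
qed

text \<open>With fewer than \<open>dim L\<close> summands isomorphic to \<open>L\<close>, some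
  nonzero \<open>x\<close> in \<open>L\<close> satisfies \<open>f U x \<one> = 0\<close> for all of
  them. By Schur's lemma every homomorphism from \<open>L\<close> to the group algebra then sends
  \<open>x\<close> to a function vanishing at the unit, which fails for the one built from a linear
  form with nonzero value at \<open>x\<close>.\<close>

lemma card_isotypic_summands_ge:
  fixes L :: "('a, 'v::ab_group_add) cplx_rep"
  assumes D: "orthogonal_decomposition G GA \<beta> D" and L: "irreducible_rep G L"
    and B: "finite B" "\<not> Modules.module.dependent (scal L) B"
      "Modules.module.span (scal L) B = vecs L"
  shows "card B \<le> card {U \<in> D. rep_iso G (subrep GA U) L}" (is "_ \<le> card ?E")
proof (rule ccontr)
  define E where "E = ?E"
  assume "\<not> card B \<le> card ?E"
  then have less: "\<not> card B \<le> card E" unfolding E_def .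
  note D' = orthogonal_decompositionD[OF D]
  note Lrep = irreducible_is_rep[OF L]
  interpret LV: vector_space "scal L" by (rule is_rep_vector_space[OF Lrep])
  interpret GV: vector_space "scal GA" by (rule vector_space_GA)
  have ED: "\<And>U. U \<in> E \<Longrightarrow> U \<in> D" and iso: "\<And>U. U \<in> E \<Longrightarrow> rep_iso G (subrep GA U) L"
    by (auto simp: E_def)
  have "\<forall>U\<in>E. \<exists>f. rep_hom G L (subrep GA U) f \<and> bij_betw f (vecs L) U"
    using rep_iso_sym[OF is_rep_subrep[OF is_rep_GA D'(2)[OF ED]] iso]
    by (auto simp: rep_iso_iff_rep_hom)
  then obtain f where f: "\<And>U. U \<in> E \<Longrightarrow> rep_hom G L (subrep GA U) (f U)"
    "\<And>U. U \<in> E \<Longrightarrow> bij_betw (f U) (vecs L) U" by metis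
  \<comment> \<open>One unknown per basis vector of \<open>L\<close>, one equation per summand; a
    solution gives the coordinates of \<open>x\<close>.\<close>
  obtain a where a: "\<exists>b\<in>B. a b \<noteq> 0" "\<forall>U\<in>E. (\<Sum>b\<in>B. a b * f U b \<one>) = 0"
    using homogeneous_system_nontrivial[of E B "\<lambda>b U. f U b \<one>"] less B(1)
      finite_subset[OF subsetI[OF ED] D'(1)] by auto
  define x where "x = (\<Sum>b\<in>B. scal L (a b) b)"
  have BL: "b \<in> vecs L" if "b \<in> B" for b using that B(3) LV.span_superset[of B] by blast
  have x: "x \<in> vecs L"
    unfolding x_def using BL is_rep_subspace[OF Lrep] by (intro LV.subspace_sum LV.subspace_scale)
  have fx0: "f U x \<one> = 0" if U: "U \<in> E" for U
  proof -
    have fGA: "rep_hom G L GA (f U)" using rep_hom_subrep[OF f(1)[OF U]] D'(4)[OF ED[OF U]] by auto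
    have "f U x = (\<Sum>b\<in>B. scal GA (a b) (f U b))"
      unfolding x_def using B(1) BL by (rule rep_hom_sum[OF Lrep is_rep_GA fGA])
    then show ?thesis using a(2) U by (simp add: sum_fun_apply scal_GA)
  qed
  obtain b0 where b0: "b0 \<in> B" "a b0 \<noteq> 0" using a(1) by blast
  \<comment> \<open>A coordinate form that does not vanish on \<open>x\<close>.\<close>
  define l where "l u = LV.representation B u b0" for u
  have l_x: "l x = a b0"
  proof -
    have "LV.representation B x = (\<lambda>c. \<Sum>b\<in>B. LV.representation B (scal L (a b) b) c)"
      unfolding x_def using B(2) by (intro LV.representation_sum) (auto intro: LV.span_scale LV.span_base)
    also have "\<dots> = (\<lambda>c. \<Sum>b\<in>B. if b = c then a b else 0)"
      by (intro ext sum.cong)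
        (auto simp: LV.representation_scale[OF B(2)] LV.span_base LV.representation_basis[OF B(2)])
    finally show ?thesis using B(1) b0(1) by (simp add: l_def)
  qed
  \<comment> \<open>The matrix coefficients of \<open>L\<close> for the form \<open>l\<close>;
    evaluation at the unit gives back \<open>l\<close>.\<close>
  define \<phi> where "\<phi> u = (\<lambda>g. if g \<in> carrier G then l (act L (inv g) u) else 0)" for u
  have \<phi>: "rep_hom G L GA \<phi>"
  proof (rule rep_homI)
    fix u v assume "u \<in> vecs L" "v \<in> vecs L"
    then show "\<phi> (u + v) = \<phi> u + \<phi> v"
      using is_rep_act_closed[OF Lrep]
      by (auto simp: \<phi>_def l_def is_rep_act_add[OF Lrep] LV.representation_add[OF B(2)] B(3) fun_eq_iff)
  next
    fix c u assume "u \<in> vecs L"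
    then show "\<phi> (scal L c u) = scal GA c (\<phi> u)"
      using is_rep_act_closed[OF Lrep]
      by (auto simp: \<phi>_def l_def is_rep_act_scal[OF Lrep] LV.representation_scale[OF B(2)] B(3) scal_GA)
  next
    fix g u assume g: "g \<in> carrier G" and u: "u \<in> vecs L"
    show "\<phi> (act L g u) = act GA g (\<phi> u)"
    proof
      fix h
      show "\<phi> (act L g u) h = act GA g (\<phi> u) h"
      proof (cases "h \<in> carrier G")
        case True
        then have "inv (inv g \<otimes> h) = inv h \<otimes> g" using g by (simp add: inv_mult_group)
        then show ?thesis
          using True g u is_rep_act_mult[OF Lrep inv_closed[OF True] g u]
          by (simp add: \<phi>_def act_GA)
      qed (simp add: \<phi>_def act_GA g)
    qed
  qed (simp add: \<phi>_def vecs_GA)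
  obtain P where P: "\<And>U. U \<in> D \<Longrightarrow> rep_hom G GA (subrep GA U) (P U)"
    "\<And>x. x \<in> V \<Longrightarrow> x = (\<Sum>U\<in>D. P U x)"
    using decomposition_projections[OF is_rep_GA D] by blast
  \<comment> \<open>By Schur's lemma the component of \<phi> in \<open>U\<close> is zero, or
    \<open>U\<close> belongs to \<open>E\<close> and the component is a multiple of
    \<open>f U\<close>.\<close>
  have "P U (\<phi> x) \<one> = 0" if U: "U \<in> D" for U
  proof -
    have hom: "rep_hom G L (subrep GA U) (\<lambda>u. P U (\<phi> u))"
      by (rule rep_hom_comp[OF \<phi> P(1)[OF U]])
    show ?thesis
    proof (cases "\<exists>u\<in>vecs L. P U (\<phi> u) \<noteq> 0")
      case True
      then have "bij_betw (\<lambda>u. P U (\<phi> u)) (vecs L) (vecs (subrep GA U))"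
        by (rule schur_bij[OF L D'(3)[OF U] hom])
      then have "rep_iso G L (subrep GA U)" using hom unfolding rep_iso_iff_rep_hom by blast
      then have E: "U \<in> E" using rep_iso_sym[OF Lrep] U by (auto simp: E_def)
      obtain c where "\<And>u. u \<in> vecs L \<Longrightarrow> P U (\<phi> u) = scal GA c (f U u)"
        using schur_scalar[OF L irreducible_is_rep[OF D'(3)[OF U]] hom f(1)[OF E]] f(2)[OF E] by auto
      then show ?thesis using x fx0[OF E] by (simp add: scal_GA)
    next
      case False
      then show ?thesis using x by simp
    qed
  qed
  then have "(\<Sum>U\<in>D. P U (\<phi> x)) \<one> = 0" by (simp add: sum_fun_apply)
  then have "\<phi> x \<one> = 0" using P(2)[OF rep_hom_closed[OF \<phi> x]] by simp
  then show False using l_x b0(2) is_rep_act_one[OF Lrep x] by (simp add: \<phi>_def)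
qed

section \<open>The signature on an isotypic component\<close>

lemma signature_count_beta_infinity:
  fixes L :: "('a, 'v::ab_group_add) cplx_rep"
  assumes D: "orthogonal_decomposition G GA \<beta> D" and L: "irreducible_rep G L"
  shows "of_int (signature_count G GA \<beta> D L) = rep_character L w0"
proof -
  note D' = orthogonal_decompositionD[OF D]
  note Lrep = irreducible_is_rep[OF L]
  interpret LV: vector_space "scal L" by (rule is_rep_vector_space[OF Lrep])
  obtain P Q where PQ: "finite P" "finite Q" "P \<inter> Q = {}"
    "LV.independent (P \<union> Q)" "LV.span (P \<union> Q) = vecs L"
    "\<And>x. x \<in> P \<Longrightarrow> act L w0 x = x" "\<And>x. x \<in> Q \<Longrightarrow> act L w0 x = - x"
    "rep_character L w0 = of_nat (card P) - of_nat (card Q)"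
    using rep_character_involution[OF Lrep w0_closed w0_w0] by blast
  let ?iso = "\<lambda>U. rep_iso G (subrep GA U) L"
  let ?Dp = "{U \<in> D. ?iso U \<and> positive_definite_on U \<beta>}"
  let ?Dm = "{U \<in> D. ?iso U \<and> negative_definite_on U \<beta>}"
  have "card ?Dp \<le> card P"
    by (rule card_sign_summands_le[OF D L, where B = "P \<union> Q" and s = 1])
      (use PQ in \<open>auto simp: positive_definite_on_def\<close>)
  moreover have "card ?Dm \<le> card Q"
    by (rule card_sign_summands_le[OF D L, where B = "P \<union> Q" and s = "-1"])
      (use PQ in \<open>auto simp: negative_definite_on_def\<close>)
  moreover have "card (P \<union> Q) \<le> card {U \<in> D. ?iso U}"
    by (rule card_isotypic_summands_ge[OF D L _ PQ(4,5)]) (use PQ in simp)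
  then have "card P + card Q \<le> card {U \<in> D. ?iso U}"
    using PQ by (simp add: card_Un_disjoint)
  moreover have "card {U \<in> D. ?iso U} \<le> card ?Dp + card ?Dm"
  proof -
    have "{U \<in> D. ?iso U} \<subseteq> ?Dp \<union> ?Dm" using decomposition_definite[OF D] by blast
    then have "card {U \<in> D. ?iso U} \<le> card (?Dp \<union> ?Dm)" using D'(1) by (intro card_mono) auto
    then show ?thesis using card_Un_le[of ?Dp ?Dm] by linarith
  qed
  \<comment> \<open>The upper bounds for the two signs add up to the lower bound for their total, so
    neither can be strict.\<close>
  ultimately have "card ?Dp = card P" "card ?Dm = card Q" by linarith+
  then show ?thesis by (simp add: signature_count_def PQ(8))
qed

text \<open>The signature has to be an integer-valued function of \<open>L\<close>. On irreducible
  \<open>L\<close> the character value is an integer, so taking the floor of its real part recovers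
  it.\<close>

theorem signature_character_beta_infinity:
  "has_signature_character G GA \<beta> (\<lambda>L :: ('a, 'v::ab_group_add) cplx_rep. \<lfloor>Re (rep_character L w0)\<rfloor>)"
proof -
  have "\<lfloor>Re (rep_character L w0)\<rfloor> = signature_count G GA \<beta> D L"
    if "orthogonal_decomposition G GA \<beta> D" "irreducible_rep G L"
    for D and L :: "('a, 'v::ab_group_add) cplx_rep"
    using signature_count_beta_infinity[OF that, symmetric] by simp
  then show ?thesis
    unfolding has_signature_character_def
    using is_rep_GA hermitian_beta invariant_beta nondegenerate_beta exists_orthogonal_decomposition
      decomposition_definite by blast
qed

end

section \<open>The longest element of the symmetric group\<close>

definition inversions :: "nat \<Rightarrow> (nat \<Rightarrow> nat) \<Rightarrow> (nat \<times> nat) set" where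
  "inversions N w = {(a, b). 1 \<le> a \<and> a < b \<and> b \<le> N \<and> w b < w a}"

text \<open>The product of simple reflections that occurs in \<open>coxeter_length\<close>, named so
  that words can be treated by induction from the right.\<close>

definition simple_word :: "nat list \<Rightarrow> nat \<Rightarrow> nat" where
  "simple_word is = foldr (\<circ>) (map (\<lambda>i. transpose i (Suc i)) is) id"

lemma simple_word_Nil [simp]: "simple_word [] = id"
  by (simp add: simple_word_def)

lemma simple_word_snoc: "simple_word (is @ [i]) = simple_word is \<circ> transpose i (Suc i)"
proof -
  have "foldr (\<circ>) fs h = foldr (\<circ>) fs id \<circ> h" for fs :: "('a \<Rightarrow> 'a) list" and h
    by (induction fs) (auto simp: comp_assoc)
  from this[of _ "transpose i (Suc i)"] show ?thesis
    by (simp add: simple_word_def)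
qed

lemma finite_inversions: "finite (inversions N w)"
  by (rule finite_subset[of _ "{1..N} \<times> {1..N}"]) (auto simp: inversions_def)

text \<open>The transposition of \<open>i\<close> and \<open>Suc i\<close> preserves the order of
  every pair of positions except these two. It thus carries the inversions of \<open>w\<close> to
  those of the product, apart from the new inversion \<open>(i, Suc i)\<close>.\<close>

lemma inversions_ascent:
  assumes "i \<in> {1..<N}" and "w i < w (Suc i)"
  shows "card (inversions N (w \<circ> transpose i (Suc i))) = Suc (card (inversions N w))"
proof -
  let ?s = "transpose i (Suc i)"
  have "inversions N (w \<circ> ?s) = insert (i, Suc i) (map_prod ?s ?s ` inversions N w)"
  proof (intro equalityI subsetI)
    fix p assume p: "p \<in> inversions N (w \<circ> ?s)"
    then obtain a b where ab: "p = (a, b)" "1 \<le> a" "a < b" "b \<le> N" "w (?s b) < w (?s a)"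
      by (auto simp: inversions_def)
    show "p \<in> insert (i, Suc i) (map_prod ?s ?s ` inversions N w)"
    proof (cases "p = (i, Suc i)")
      case False
      then have "(?s a, ?s b) \<in> inversions N w"
        using ab assms(1) by (auto simp: inversions_def transpose_def split: if_splits)
      then have "map_prod ?s ?s (?s a, ?s b) \<in> map_prod ?s ?s ` inversions N w"
        by (rule imageI)
      then show ?thesis using ab by simp
    qed simp
  next
    fix p assume "p \<in> insert (i, Suc i) (map_prod ?s ?s ` inversions N w)"
    then show "p \<in> inversions N (w \<circ> ?s)"
    proof
      assume "p \<in> map_prod ?s ?s ` inversions N w"
      then obtain a b where ab: "p = (?s a, ?s b)" "1 \<le> a" "a < b" "b \<le> N" "w b < w a"
        by (auto simp: inversions_def)
      then have "(a, b) \<noteq> (i, Suc i)" using assms by auto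
      then have "1 \<le> ?s a \<and> ?s a < ?s b \<and> ?s b \<le> N"
        using ab assms(1) by (auto simp: transpose_def split: if_splits)
      then show ?thesis using ab by (simp add: inversions_def)
    qed (use assms in \<open>auto simp: inversions_def\<close>)
  qed
  moreover have "(i, Suc i) \<notin> map_prod ?s ?s ` inversions N w"
  proof
    assume "(i, Suc i) \<in> map_prod ?s ?s ` inversions N w"
    then obtain a b where "i = ?s a" "Suc i = ?s b" "a < b"
      by (auto simp: inversions_def)
    then show False by (auto simp: transpose_def split: if_splits)
  qed
  moreover have "card (map_prod ?s ?s ` inversions N w) = card (inversions N w)"
    by (intro card_image map_prod_inj_on[THEN inj_on_subset[of _ "UNIV \<times> UNIV"]]) auto
  ultimately show ?thesis by (simp add: finite_inversions)
qed

lemma simple_reflection_permutes: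
  "i \<in> {1..<N} \<Longrightarrow> transpose i (Suc i) permutes {1..N}"
  by (intro permutes_swap_id) auto

text \<open>After the transposition the descent is an ascent, and transposing again restores
  \<open>w\<close>.\<close>

lemma inversions_descent:
  assumes "i \<in> {1..<N}" and "w (Suc i) < w i"
  shows "card (inversions N w) = Suc (card (inversions N (w \<circ> transpose i (Suc i))))"
  using inversions_ascent[OF assms(1), of "w \<circ> transpose i (Suc i)"] assms(2)
  by (simp add: comp_assoc)

text \<open>Each further letter changes the number of inversions by exactly one, so a word is at
  least as long as its product has inversions.\<close>

lemma card_inversions_simple_word:
  "set is \<subseteq> {1..<N} \<Longrightarrow>
     simple_word is permutes {1..N} \<and> card (inversions N (simple_word is)) \<le> length is"
proof (induction "is" rule: rev_induct)
  case Nil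
  have "inversions N id = {}" by (auto simp: inversions_def)
  then show ?case by (simp only: simple_word_Nil permutes_id) simp
next
  case (snoc i "is")
  let ?w = "simple_word is"
  have i: "i \<in> {1..<N}" and w: "?w permutes {1..N}" and le: "card (inversions N ?w) \<le> length is"
    using snoc by auto
  have "?w i \<noteq> ?w (Suc i)"
    using permutes_inj[OF w] by (metis injD n_not_Suc_n)
  then have "?w i < ?w (Suc i) \<or> ?w (Suc i) < ?w i" by auto
  then have "card (inversions N (?w \<circ> transpose i (Suc i))) \<le> length (is @ [i])"
  proof
    assume "?w i < ?w (Suc i)"
    then show ?thesis using inversions_ascent[OF i, of ?w] le by simp
  next
    assume "?w (Suc i) < ?w i"
    then show ?thesis using inversions_descent[OF i, of ?w] le by simp
  qed
  then show ?case
    using permutes_compose[OF simple_reflection_permutes[OF i] w] unfolding simple_word_snoc by blast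
qed

text \<open>Induction gives \<open>i \<le> w i\<close>, and a permutation of \<open>{1..N}\<close>
  that lowers no point is the identity.\<close>

lemma strict_mono_permutes_eq_id:
  fixes w :: "nat \<Rightarrow> nat"
  assumes w: "w permutes {1..N}" and "\<And>i. i \<in> {1..<N} \<Longrightarrow> w i < w (Suc i)"
  shows "w = id"
proof (rule permutes_natset_ge[OF w], rule ballI)
  have *: "1 \<le> i \<Longrightarrow> i \<le> N \<Longrightarrow> i \<le> w i" for i
  proof (induction i rule: nat_induct_at_least)
    case base
    then show ?case using permutes_in_image[OF w, of 1] by auto
  next
    case (Suc i)
    then show ?case using assms(2)[of i] by auto
  qed
  fix i assume "i \<in> {1..N}"
  then show "i \<le> w i" using * by auto
qed

text \<open>Bubble sort: each descent is removed at the cost of one letter and one inversion, until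
  no descent remains and the permutation is the identity.\<close>

lemma ex_simple_word_inversions:
  assumes "w permutes {1..N}"
  shows "\<exists>is. length is = card (inversions N w) \<and> set is \<subseteq> {1..<N} \<and> w = simple_word is"
  using assms
proof (induction "card (inversions N w)" arbitrary: w rule: less_induct)
  case less
  show ?case
  proof (cases "\<exists>i\<in>{1..<N}. w (Suc i) < w i")
    case True
    then obtain i where i: "i \<in> {1..<N}" "w (Suc i) < w i" by blast
    let ?v = "w \<circ> transpose i (Suc i)"
    have card: "card (inversions N w) = Suc (card (inversions N ?v))"
      by (rule inversions_descent[OF i])
    moreover have "?v permutes {1..N}"
      by (rule permutes_compose[OF simple_reflection_permutes[OF i(1)] less.prems])
    ultimately obtain "is" where
      "length is = card (inversions N ?v)" "set is \<subseteq> {1..<N}" "?v = simple_word is"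
      using less.hyps[of ?v] by auto
    moreover have "w = ?v \<circ> transpose i (Suc i)"
      by (simp add: comp_assoc)
    ultimately have "length (is @ [i]) = card (inversions N w) \<and> set (is @ [i]) \<subseteq> {1..<N}
        \<and> w = simple_word (is @ [i])"
      unfolding simple_word_snoc using i(1) card by auto
    then show ?thesis by blast
  next
    case False
    have "w i < w (Suc i)" if "i \<in> {1..<N}" for i
      using False that permutes_inj[OF less.prems] by (metis injD linorder_neqE_nat n_not_Suc_n)
    then have "w = id" by (rule strict_mono_permutes_eq_id[OF less.prems])
    moreover have "inversions N id = {}" by (auto simp: inversions_def)
    ultimately show ?thesis by (intro exI[of _ "[]"]) auto
  qed
qed

lemma coxeter_length_eq_card_inversions:
  assumes "w permutes {1..N}"
  shows "coxeter_length N w = card (inversions N w)"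
  unfolding coxeter_length_def simple_word_def[symmetric]
proof (rule Least_equality)
  show "\<exists>is. length is = card (inversions N w) \<and> set is \<subseteq> {1..<N} \<and> w = simple_word is"
    by (rule ex_simple_word_inversions[OF assms])
qed (use card_inversions_simple_word in blast)

text \<open>The order reversal inverts every pair, so by maximality \<open>w0\<close> does too. It
  is therefore strictly decreasing on \<open>{1..N}\<close>, and its square is increasing, hence the
  identity.\<close>

lemma longest_element_involution:
  assumes "is_longest_element N w0"
  shows "w0 \<circ> w0 = id"
proof -
  have w0: "w0 permutes {1..N}"
    and le: "\<And>w. w permutes {1..N} \<Longrightarrow> coxeter_length N w \<le> coxeter_length N w0"
    using assms by (auto simp: is_longest_element_def sym_group_carrier)
  \<comment> \<open>The order reversal, used only as a competitor whose length is the number of all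
    pairs.\<close>
  define r where "r = (\<lambda>i. if i \<in> {1..N} then Suc N - i else i)"
  have "bij_betw r {1..N} {1..N}"
    by (rule bij_betw_byWitness[of _ r]) (auto simp: r_def)
  then have r: "r permutes {1..N}"
    by (rule bij_imp_permutes) (auto simp: r_def)
  define P where "P = {(a, b). 1 \<le> a \<and> a < b \<and> b \<le> N}"
  have "inversions N r = P"
    by (auto simp: inversions_def P_def r_def)
  then have "card P \<le> card (inversions N w0)"
    using le[OF r] by (simp only: coxeter_length_eq_card_inversions[OF r] coxeter_length_eq_card_inversions[OF w0])
  moreover have "inversions N w0 \<subseteq> P" "finite P"
    by (auto simp: inversions_def P_def intro: finite_subset[of _ "{1..N} \<times> {1..N}"])
  ultimately have "inversions N w0 = P"
    by (metis card_seteq)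
  then have anti: "w0 b < w0 a" if "1 \<le> a" "a < b" "b \<le> N" for a b
    using that by (auto simp: inversions_def P_def set_eq_iff)
  show ?thesis
  proof (rule strict_mono_permutes_eq_id)
    show "w0 \<circ> w0 permutes {1..N}" by (rule permutes_compose[OF w0 w0])
    fix i assume "i \<in> {1..<N}"
    then show "(w0 \<circ> w0) i < (w0 \<circ> w0) (Suc i)"
      using anti[of i "Suc i"] anti[of "w0 (Suc i)" "w0 i"] permutes_in_image[OF w0, of i]
        permutes_in_image[OF w0, of "Suc i"] by auto
  qed
qed

theorem mainTheorem3:
  fixes N :: nat and w0 :: "nat \<Rightarrow> nat"
  assumes "N \<ge> 1" and "is_longest_element N w0"
  shows "\<exists>\<sigma> :: (nat \<Rightarrow> nat, 'u::ab_group_add) cplx_rep \<Rightarrow> int.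
    has_signature_character (sym_group N) (group_algebra (sym_group N))
      (beta_infinity (sym_group N) w0) \<sigma> \<and>
    (\<forall>L. irreducible_rep (sym_group N) L \<longrightarrow> complex_of_int (\<sigma> L) = rep_character L w0)"
proof -
  interpret group "sym_group N" by (rule sym_group_is_group)
  interpret finite_group_involution "sym_group N" w0
  proof
    show "finite (carrier (sym_group N))"
      by (simp add: sym_group_def finite_permutations)
    show "w0 \<in> carrier (sym_group N)"
      using assms(2) by (simp add: is_longest_element_def)
    show "w0 \<otimes>\<^bsub>sym_group N\<^esub> w0 = \<one>\<^bsub>sym_group N\<^esub>"
      using longest_element_involution[OF assms(2)] by (simp add: sym_group_def)
  qed
  \<comment> \<open>Integrality of the character value is read off from the signature count of some
    decomposition.\<close>
  obtain D where D: "orthogonal_decomposition (sym_group N) GA \<beta> D"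
    using exists_orthogonal_decomposition by blast
  let ?\<sigma> = "\<lambda>L :: (nat \<Rightarrow> nat, 'u) cplx_rep. \<lfloor>Re (rep_character L w0)\<rfloor>"
  have "complex_of_int (?\<sigma> L) = rep_character L w0" if "irreducible_rep (sym_group N) L" for L
    using signature_count_beta_infinity[OF D that, symmetric] by simp
  then show ?thesis using signature_character_beta_infinity by blast
qed

end
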